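(* For the tensor deletion channel with deletion probability $p$ and $q=1-p$, $\exp\Big(O\big((n(kp/q^2)^k\log^2 n)^{1/(k+2)}\big)\Big)$ traces suffice to recover an arbitrary $k$-th order tensor $T\in\{0,1\}^{n^{1/k}\times n^{1/k}\times\cdots\times n^{1/k}}$ with high probability.
   Context: The tensor deletion channel with deletion probability $p$ takes a $k$-th order tensor with $n^{1/k}$ indices along each dimension and, independently for each dimension and each index along it, deletes the corresponding slice with probability $p$; the output (a trace) is the subtensor formed by the surviving indices in their original relative order, without revealing which were deleted. "With high probability" means with probability at least $1-o(1)$ as $n\to\infty$. *)

theory Defs
  imports "HOL-Probability.Probability" "HOL-Probability.Product_PMF"
begin

(* A tensor is a partial map on 0-based multi-indices, its domain being the box of valid
   multi-indices. In particular all tensors with some dimension equal to 0 coincide. *)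
type_synonym 'a tensor = "nat list \<rightharpoonup> 'a"

definition tensor_indices :: "nat list \<Rightarrow> nat list set" where
  "tensor_indices ds = {is. list_all2 (<) is ds}"

definition cubical_tensors :: "nat \<Rightarrow> nat \<Rightarrow> 'a tensor set" where
  "cubical_tensors k m = {T. dom T = tensor_indices (replicate k m)}"

(* The j-th element of ss lists, in increasing order, the indices retained in dimension j. *)
definition subtensor :: "nat list list \<Rightarrow> 'a tensor \<Rightarrow> 'a tensor" where
  "subtensor ss T =
     (\<lambda>is. if is \<in> tensor_indices (map length ss) then T (map2 (!) ss is) else None)"

(* D (j, i) holds iff the i-th slice in dimension j is deleted. *)
definition surviving_indices :: "nat \<Rightarrow> nat \<Rightarrow> (nat \<times> nat \<Rightarrow> bool) \<Rightarrow> nat list list" where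
  "surviving_indices k m D = map (\<lambda>j. filter (\<lambda>i. \<not> D (j, i)) [0..<m]) [0..<k]"

(* The False argument of Pi_pmf is only the value of D outside the k * m slices. *)
definition tensor_deletion_channel :: "nat \<Rightarrow> nat \<Rightarrow> real \<Rightarrow> 'a tensor \<Rightarrow> 'a tensor pmf" where
  "tensor_deletion_channel k m p T =
     map_pmf (\<lambda>D. subtensor (surviving_indices k m D) T)
       (Pi_pmf ({..<k} \<times> {..<m}) False (\<lambda>_. bernoulli_pmf p))"

(* N independent traces are turned into an estimate by a deterministic rule R, which may depend
   on k, m, p and N but not on the unknown tensor T; delta bounds the failure probability for
   each individual T. *)
definition traces_suffice :: "nat \<Rightarrow> nat \<Rightarrow> real \<Rightarrow> nat \<Rightarrow> real \<Rightarrow> bool" where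
  "traces_suffice k m p N \<delta> \<longleftrightarrow>
     (\<exists>R :: bool tensor list \<Rightarrow> bool tensor. \<forall>T \<in> cubical_tensors k m.
        measure_pmf.prob (replicate_pmf N (tensor_deletion_channel k m p T)) {Xs. R Xs = T}
          \<ge> 1 - \<delta>)"

end

theory Submission
  imports Defs "HOL-Probability.Hoeffding" "HOL-Complex_Analysis.Conformal_Mappings"
    "HOL-Real_Asymp.Real_Asymp"
begin

text \<open>If \<open>z\<^sub>j = p + q w\<^sub>j\<close>, then the polynomial in \<open>w\<close> whose coefficients are the entries of a trace has
  expectation \<open>q\<^sup>k\<close> times the polynomial in \<open>z\<close> whose coefficients are the entries of \<open>T\<close>. For two
  distinct tensors the difference of the latter is a nonzero polynomial with coefficients in
  \<open>{-1, 0, 1}\<close>; multiplying its rotations by the \<open>L\<close>-th roots of unity in each variable and applying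
  the maximum modulus principle shows that it has modulus at least \<open>n\<close> to the power
  \<open>1 - L\<^sup>k\<close> at some point \<open>z\<close> of the torus whose arguments are at most \<open>\<pi>/L\<close>. There \<open>w\<close> is so close
  to the unit circle that the statistic is at most \<open>n exp (\<pi>\<^sup>2 k m p / (2 q\<^sup>2 L\<^sup>2))\<close>, so Hoeffding's
  inequality and a union bound over the \<open>4\<^sup>n\<close> pairs of tensors identify \<open>T\<close>. The choice
  \<open>L \<approx> (m p / (q\<^sup>2 ln m))\<close> to the power \<open>1/(k+2)\<close> balances the two exponents. It requires
  \<open>L \<ge> 1\<close>; if \<open>m p / q\<^sup>2 \<le> ln m\<close>, the number of traces allowed already suffices to see, with high
  probability, a trace without any deletion.\<close>

section \<open>Testing hypotheses from independent samples\<close>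

text \<open>Chernoff's method: Markov's inequality for the exponential of the centred sum, where
  Hoeffding's lemma on the range from \<open>- M\<close> to \<open>M\<close> bounds the contribution
  of each sample by \<open>exp (l\<^sup>2 * M\<^sup>2 / 2)\<close>.\<close>

lemma replicate_pmf_upper_tail:
  fixes g :: "'a \<Rightarrow> real" and p :: "'a pmf" and M t :: real and N :: nat
  assumes M: "M > 0" "\<And>x. \<bar>g x\<bar> \<le> M" and t: "t > 0"
  defines "\<mu> \<equiv> measure_pmf.expectation p g"
  shows "measure_pmf.prob (replicate_pmf N p) {xs. sum_list (map (\<lambda>x. g x - \<mu>) xs) \<ge> real N * t}
    \<le> exp (- real N * t\<^sup>2 / (2 * M\<^sup>2))"
proof -
  interpret interval_bounded_random_variable "measure_pmf p" g "- M" M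
    by unfold_locales (use M(2) in \<open>auto simp: abs_le_iff minus_le_iff\<close>)
  \<comment> \<open>This value minimises the final exponent
    \<open>- l * real N * t + N * (l\<^sup>2 * M\<^sup>2 / 2)\<close>.\<close>
  define l where "l = t / M\<^sup>2"
  have l: "l > 0" using M t by (simp add: l_def)
  let ?S = "\<lambda>xs. sum_list (map (\<lambda>x. g x - \<mu>) xs)"
  \<comment> \<open>Independence makes the integral factorise, one sample at a time. Nonnegative
    integrals spare any argument about integrability.\<close>
  have mgf: "(\<integral>\<^sup>+xs. ennreal (exp (l * ?S xs)) \<partial>measure_pmf (replicate_pmf N p))
      \<le> ennreal (exp (l\<^sup>2 * M\<^sup>2 / 2)) ^ N"
  proof (induction N)
    case (Suc N)
    have "(\<integral>\<^sup>+xs. ennreal (exp (l * ?S xs)) \<partial>measure_pmf (replicate_pmf (Suc N) p))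
        = (\<integral>\<^sup>+x. ennreal (exp (l * (g x - \<mu>))) \<partial>p) * (\<integral>\<^sup>+xs. ennreal (exp (l * ?S xs)) \<partial>measure_pmf (replicate_pmf N p))"
      by (simp add: nn_integral_bind_pmf nn_integral_return_pmf distrib_left exp_add ennreal_mult
          nn_integral_cmult nn_integral_multc)
    also have "\<dots> \<le> ennreal (exp (l\<^sup>2 * M\<^sup>2 / 2)) * ennreal (exp (l\<^sup>2 * M\<^sup>2 / 2)) ^ N"
      using Hoeffdings_lemma_nn_integral[OF l] Suc
      by (intro mult_mono) (auto simp: \<mu>_def power_mult_distrib mult.commute)
    finally show ?case by simp
  qed simp
  have "ennreal (measure_pmf.prob (replicate_pmf N p) {xs. ?S xs \<ge> real N * t})
      = (\<integral>\<^sup>+xs. indicator {xs. ?S xs \<ge> real N * t} xs \<partial>measure_pmf (replicate_pmf N p))"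
    by (simp add: measure_pmf.emeasure_eq_measure)
  also have "\<dots> \<le> (\<integral>\<^sup>+xs. ennreal (exp (- l * real N * t)) * ennreal (exp (l * ?S xs)) \<partial>measure_pmf (replicate_pmf N p))"
  proof (intro nn_integral_mono)
    fix xs
    have "1 \<le> exp (- l * real N * t + l * ?S xs)" if "?S xs \<ge> N * t"
      using mult_left_mono[OF that, of l] l by (simp add: mult_ac)
    thus "indicator {xs. ?S xs \<ge> real N * t} xs \<le> ennreal (exp (- l * real N * t)) * ennreal (exp (l * ?S xs))"
      by (auto simp: indicator_def ennreal_mult[symmetric] exp_add[symmetric])
  qed
  also have "\<dots> = ennreal (exp (- l * real N * t)) * (\<integral>\<^sup>+xs. ennreal (exp (l * ?S xs)) \<partial>measure_pmf (replicate_pmf N p))"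
    by (rule nn_integral_cmult) auto
  also have "\<dots> \<le> ennreal (exp (- l * real N * t)) * ennreal (exp (l\<^sup>2 * M\<^sup>2 / 2)) ^ N"
    by (intro mult_left_mono mgf) auto
  also have "\<dots> = ennreal (exp (- l * real N * t + N * (l\<^sup>2 * M\<^sup>2 / 2)))"
    by (simp only: ennreal_power exp_ge_zero ennreal_mult[symmetric] zero_le_power
        exp_of_nat_mult[symmetric] exp_add[symmetric])
  also have "- l * real N * t + N * (l\<^sup>2 * M\<^sup>2 / 2) = - real N * t\<^sup>2 / (2 * M\<^sup>2)"
    using M(1) by (simp add: l_def field_simps power2_eq_square)
  finally show ?thesis by (simp add: ennreal_le_iff)
qed

lemma replicate_pmf_two_sided_tail:
  fixes g :: "'a \<Rightarrow> real" and p :: "'a pmf" and M t :: real and N :: nat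
  assumes M: "M > 0" "\<And>x. \<bar>g x\<bar> \<le> M" and t: "t > 0"
  defines "\<mu> \<equiv> measure_pmf.expectation p g"
  shows "measure_pmf.prob (replicate_pmf N p) {xs. \<bar>sum_list (map (\<lambda>x. g x - \<mu>) xs)\<bar> \<ge> N * t}
    \<le> 2 * exp (- real N * t\<^sup>2 / (2 * M\<^sup>2))"
proof -
  let ?P = "measure_pmf.prob (replicate_pmf N p)"
  let ?A = "{xs. sum_list (map (\<lambda>x. g x - \<mu>) xs) \<ge> N * t}"
  let ?B = "{xs. sum_list (map (\<lambda>x. - g x - measure_pmf.expectation p (\<lambda>x. - g x)) xs) \<ge> N * t}"
  have neg: "sum_list (map (\<lambda>x. - g x - measure_pmf.expectation p (\<lambda>x. - g x)) xs)
      = - sum_list (map (\<lambda>x. g x - \<mu>) xs)" for xs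
    by (simp add: \<mu>_def uminus_sum_list_map o_def)
  have "?P {xs. \<bar>sum_list (map (\<lambda>x. g x - \<mu>) xs)\<bar> \<ge> N * t} \<le> ?P (?A \<union> ?B)"
    unfolding neg by (intro measure_pmf.finite_measure_mono) auto
  also have "\<dots> \<le> ?P ?A + ?P ?B"
    by (intro measure_Un_le) auto
  also have "\<dots> \<le> exp (- real N * t\<^sup>2 / (2 * M\<^sup>2)) + exp (- real N * t\<^sup>2 / (2 * M\<^sup>2))"
  proof (rule add_mono)
    show "?P ?A \<le> exp (- real N * t\<^sup>2 / (2 * M\<^sup>2))"
      unfolding \<mu>_def by (rule replicate_pmf_upper_tail[OF M t])
    show "?P ?B \<le> exp (- real N * t\<^sup>2 / (2 * M\<^sup>2))"
      by (rule replicate_pmf_upper_tail[OF M(1) _ t]) (use M(2) in simp)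
  qed
  finally show ?thesis by simp
qed

lemma sum_list_map_diff_const:
  fixes g :: "'a \<Rightarrow> real" and c :: real
  shows "sum_list (map (\<lambda>x. g x - c) xs) = sum_list (map g xs) - real (length xs) * c"
  by (induction xs) (auto simp: algebra_simps)

text \<open>A hypothesis passes if, for the test function of every pair, the empirical mean lies
  within \<open>\<Delta> / 2\<close> of the expectation under that hypothesis. Two distinct
  hypotheses cannot both pass, because the test of their own pair separates them by
  \<open>\<Delta>\<close>; the true one is rejected with a probability controlled by the tail bound
  and a union bound over all pairs.\<close>

lemma pairwise_tests_suffice:
  fixes D :: "'a \<Rightarrow> 'x pmf" and \<Theta> :: "'a set" and M \<Delta> :: real and N :: nat
  assumes fin: "finite \<Theta>" and N: "N > 0" and M: "M > 0" and \<Delta>: "\<Delta> > 0"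
    and sep: "\<And>S T. S \<in> \<Theta> \<Longrightarrow> T \<in> \<Theta> \<Longrightarrow> S \<noteq> T \<Longrightarrow> \<exists>g. (\<forall>x. \<bar>g x\<bar> \<le> M) \<and>
      \<Delta> \<le> \<bar>measure_pmf.expectation (D S) g - measure_pmf.expectation (D T) g\<bar>"
  shows "\<exists>R. \<forall>T\<in>\<Theta>. measure_pmf.prob (replicate_pmf N (D T)) {Xs. R Xs = T}
    \<ge> 1 - 2 * (real (card \<Theta>))\<^sup>2 * exp (- real N * \<Delta>\<^sup>2 / (8 * M\<^sup>2))"
proof -
  define P where "P = {(S, T). S \<in> \<Theta> \<and> T \<in> \<Theta> \<and> S \<noteq> T}"
  have P: "P \<subseteq> \<Theta> \<times> \<Theta>" by (auto simp: P_def)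
  have "\<exists>h. \<forall>c\<in>P. (\<forall>x. \<bar>h c x\<bar> \<le> M) \<and>
      \<Delta> \<le> \<bar>measure_pmf.expectation (D (fst c)) (h c) - measure_pmf.expectation (D (snd c)) (h c)\<bar>"
    by (rule bchoice) (use sep in \<open>auto simp: P_def\<close>)
  then obtain h where hM: "\<And>c x. c \<in> P \<Longrightarrow> \<bar>h c x\<bar> \<le> M"
    and h\<Delta>: "\<And>c. c \<in> P \<Longrightarrow>
      \<Delta> \<le> \<bar>measure_pmf.expectation (D (fst c)) (h c) - measure_pmf.expectation (D (snd c)) (h c)\<bar>"
    by blast
  define \<mu> where "\<mu> = (\<lambda>T c. measure_pmf.expectation (D T) (h c))"
  define ok where "ok = (\<lambda>Xs T. T \<in> \<Theta> \<and>
    (\<forall>c\<in>P. \<bar>sum_list (map (\<lambda>x. h c x - \<mu> T c) Xs)\<bar> < N * (\<Delta> / 2)))"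
  have uniq: "S = T" if "ok Xs S" "ok Xs T" "length Xs = N" for S T Xs
  proof (rule ccontr)
    assume "S \<noteq> T"
    hence c: "(S, T) \<in> P" using that by (auto simp: ok_def P_def)
    let ?s = "sum_list (map (h (S, T)) Xs)"
    have "\<bar>?s - N * \<mu> S (S, T)\<bar> < N * (\<Delta> / 2)" "\<bar>?s - N * \<mu> T (S, T)\<bar> < N * (\<Delta> / 2)"
      using bspec[OF conjunct2[OF that(1)[unfolded ok_def]] c]
        bspec[OF conjunct2[OF that(2)[unfolded ok_def]] c] that(3)
      by (simp_all add: sum_list_map_diff_const)
    hence "\<bar>N * (\<mu> S (S, T) - \<mu> T (S, T))\<bar> < N * \<Delta>" by (simp add: algebra_simps abs_if split: if_splits)
    hence "\<bar>\<mu> S (S, T) - \<mu> T (S, T)\<bar> < \<Delta>" using N by (simp add: abs_mult)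
    thus False using h\<Delta>[OF c] by (simp add: \<mu>_def)
  qed
  define R where "R = (\<lambda>Xs. SOME T. ok Xs T)"
  show ?thesis
  proof (intro exI[of _ R] ballI)
    fix T assume T: "T \<in> \<Theta>"
    let ?P = "measure_pmf.prob (replicate_pmf N (D T))"
    define B where "B = (\<lambda>c. {Xs. \<bar>sum_list (map (\<lambda>x. h c x - \<mu> T c) Xs)\<bar> \<ge> N * (\<Delta> / 2)})"
    have finP: "finite P" using fin P finite_subset by blast
    \<comment> \<open>\<open>uniq\<close> asks for samples of length \<open>N\<close>, which is
      known for lists in the support; hence the almost-sure comparison of events that
      follows.\<close>
    have "R Xs = T" if "Xs \<notin> (\<Union>c\<in>P. B c)" "Xs \<in> set_pmf (replicate_pmf N (D T))" for Xs
    proof -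
      have okT: "ok Xs T" using that(1) T by (auto simp: ok_def B_def not_le)
      hence "ok Xs (R Xs)" unfolding R_def by (rule someI)
      with okT uniq that(2) show ?thesis by (auto simp: set_replicate_pmf)
    qed
    hence "1 - ?P (\<Union>c\<in>P. B c) \<le> ?P {Xs. R Xs = T}"
      unfolding measure_pmf.prob_compl[of "\<Union>c\<in>P. B c" "replicate_pmf N (D T)", simplified, symmetric]
      by (intro measure_pmf.finite_measure_mono_AE) (auto simp: AE_measure_pmf_iff)
    moreover have "?P (\<Union>c\<in>P. B c) \<le> (\<Sum>c\<in>P. ?P (B c))"
      by (intro measure_pmf.finite_measure_subadditive_finite finP) auto
    moreover have "\<dots> \<le> (\<Sum>c\<in>P. 2 * exp (- real N * (\<Delta> / 2)\<^sup>2 / (2 * M\<^sup>2)))"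
    proof (rule sum_mono)
      fix c assume "c \<in> P"
      thus "?P (B c) \<le> 2 * exp (- real N * (\<Delta> / 2)\<^sup>2 / (2 * M\<^sup>2))"
        unfolding B_def \<mu>_def using replicate_pmf_two_sided_tail[where M = M and g = "h c" and t = "\<Delta> / 2"] M hM \<Delta> by simp
    qed
    moreover have "\<dots> = real (card P) * (2 * exp (- real N * \<Delta>\<^sup>2 / (8 * M\<^sup>2)))"
      by (simp add: power_divide mult.assoc)
    moreover have "card P \<le> card (\<Theta> \<times> \<Theta>)" by (intro card_mono finite_cartesian_product fin P)
    hence "real (card P) \<le> (real (card \<Theta>))\<^sup>2"
      by (simp add: card_cartesian_product power2_eq_square flip: of_nat_mult)
    hence "real (card P) * (2 * exp (- real N * \<Delta>\<^sup>2 / (8 * M\<^sup>2)))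
        \<le> (real (card \<Theta>))\<^sup>2 * (2 * exp (- real N * \<Delta>\<^sup>2 / (8 * M\<^sup>2)))"
      by (rule mult_right_mono) auto
    ultimately show "?P {Xs. R Xs = T} \<ge> 1 - 2 * (real (card \<Theta>))\<^sup>2 * exp (- real N * \<Delta>\<^sup>2 / (8 * M\<^sup>2))"
      by linarith
  qed
qed

text \<open>Independence in product form, over a normed field because the factors will be complex.
  Finite supports turn the integrals into finite sums.\<close>

lemma expectation_prod_Pi_pmf_finite:
  fixes f :: "'a \<Rightarrow> 'b \<Rightarrow> 'c::{real_normed_field, banach, second_countable_topology}"
  assumes "finite A" "\<And>x. x \<in> A \<Longrightarrow> finite (set_pmf (p x))"
  shows "measure_pmf.expectation (Pi_pmf A d p) (\<lambda>y. \<Prod>x\<in>A. f x (y x))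
    = (\<Prod>x\<in>A. measure_pmf.expectation (p x) (f x))"
  using assms
proof (induction A rule: finite_induct)
  case (insert x A)
  have finPi: "finite (set_pmf (Pi_pmf A d p))"
    using insert by (subst set_Pi_pmf) (auto intro!: finite_PiE_dflt)
  have "measure_pmf.expectation (Pi_pmf (insert x A) d p) (\<lambda>y. \<Prod>x\<in>insert x A. f x (y x))
      = (\<Sum>a\<in>set_pmf (p x). pmf (p x) a *\<^sub>R
          measure_pmf.expectation (map_pmf (\<lambda>y. y(x := a)) (Pi_pmf A d p)) (\<lambda>y. \<Prod>x\<in>insert x A. f x (y x)))"
    unfolding Pi_pmf_insert'[OF insert.hyps] map_pmf_def[symmetric]
    by (rule pmf_expectation_bind) (use insert finPi in auto)
  also have "\<dots> = (\<Sum>a\<in>set_pmf (p x). pmf (p x) a *\<^sub>R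
      (f x a * measure_pmf.expectation (Pi_pmf A d p) (\<lambda>y. \<Prod>x\<in>A. f x (y x))))"
  proof -
    have "(\<Prod>z\<in>insert x A. f z ((y(x := a)) z)) = f x a * (\<Prod>z\<in>A. f z (y z))" for y a
      using insert.hyps by (auto intro!: prod.cong)
    thus ?thesis by simp
  qed
  also have "\<dots> = measure_pmf.expectation (p x) (f x) * (\<Prod>x\<in>A. measure_pmf.expectation (p x) (f x))"
    using insert by (simp add: integral_measure_pmf[of "set_pmf (p x)"] sum_distrib_right)
  finally show ?case using insert.hyps by simp
qed simp

section \<open>Tensors and traces\<close>

text \<open>\<open>map2\<close> truncates to the shorter list, so length conditions appear only
  where the product is indexed by positions.\<close>

definition monomial :: "'a::comm_monoid_mult list \<Rightarrow> nat list \<Rightarrow> 'a" where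
  "monomial zs is = prod_list (map2 (^) zs is)"

lemma monomial_simps [simp]:
  "monomial [] is = 1" "monomial zs [] = 1"
  "monomial (z # zs) (i # is) = z ^ i * monomial zs is"
  by (simp_all add: monomial_def)

lemma norm_monomial_eq_1:
  fixes zs :: "complex list"
  assumes "\<forall>z\<in>set zs. norm z = 1"
  shows "norm (monomial zs is) = 1"
  using assms
proof (induction zs arbitrary: "is")
  case (Cons z zs)
  thus ?case by (cases "is") (auto simp: norm_mult norm_power)
qed simp

lemma tensor_indices_Nil [simp]: "tensor_indices [] = {[]}"
  by (auto simp: tensor_indices_def)

lemma tensor_indices_Cons: "tensor_indices (d # ds) = (\<lambda>(i, is). i # is) ` ({..<d} \<times> tensor_indices ds)"
  by (auto simp: tensor_indices_def list_all2_Cons2 image_iff)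

lemma finite_tensor_indices [simp]: "finite (tensor_indices ds)"
  by (induction ds) (auto simp: tensor_indices_Cons)

lemma card_tensor_indices: "card (tensor_indices ds) = prod_list ds"
proof (induction ds)
  case (Cons d ds)
  have "inj_on (\<lambda>(i, is). i # is) X" for X :: "(nat \<times> nat list) set" by (auto simp: inj_on_def)
  thus ?case by (simp add: tensor_indices_Cons card_image card_cartesian_product Cons)
qed simp

lemma sum_tensor_indices_Cons:
  "(\<Sum>is\<in>tensor_indices (d # ds). f is) = (\<Sum>i<d. \<Sum>is\<in>tensor_indices ds. f (i # is))"
proof -
  have "inj_on (\<lambda>(i, is). i # is) X" for X :: "(nat \<times> nat list) set" by (auto simp: inj_on_def)
  thus ?thesis
    by (simp add: tensor_indices_Cons sum.reindex sum.cartesian_product case_prod_unfold)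
qed


text \<open>A boolean tensor on a fixed box is determined by the set of positions that hold
  \<open>True\<close>, which injects the tensors into the subsets of a box with \<open>m ^ k\<close>
  elements.\<close>

lemma cubical_tensors_finite_card:
  "finite (cubical_tensors k m :: bool tensor set)"
  "card (cubical_tensors k m :: bool tensor set) \<le> 2 ^ (m ^ k)"
proof -
  let ?A = "tensor_indices (replicate k m)"
  let ?f = "\<lambda>T :: bool tensor. {is \<in> ?A. T is = Some True}"
  have inj: "inj_on ?f (cubical_tensors k m)"
  proof (rule inj_onI, rule ext)
    fix S T :: "bool tensor" and "is"
    assume S: "S \<in> cubical_tensors k m" and T: "T \<in> cubical_tensors k m" and eq: "?f S = ?f T"
    show "S is = T is"
    proof (cases "is \<in> ?A")
      case True
      then obtain a b where "S is = Some a" "T is = Some b"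
        using S T by (force simp: cubical_tensors_def)
      moreover have "is \<in> ?f S \<longleftrightarrow> is \<in> ?f T" unfolding eq ..
      ultimately show ?thesis using True by (cases a; cases b) simp_all
    next
      case False
      hence "is \<notin> dom S" "is \<notin> dom T" using S T by (simp_all add: cubical_tensors_def)
      thus ?thesis by (simp add: domIff)
    qed
  qed
  have sub: "?f ` cubical_tensors k m \<subseteq> Pow ?A" by auto
  show "finite (cubical_tensors k m :: bool tensor set)"
    using inj sub by (rule inj_on_finite) simp
  have "card (cubical_tensors k m :: bool tensor set) \<le> card (Pow ?A)"
    using inj sub by (rule card_inj_on_le) simp
  thus "card (cubical_tensors k m :: bool tensor set) \<le> 2 ^ (m ^ k)"
    by (simp add: card_Pow card_tensor_indices)
qed

section \<open>Recovery from a trace without deletions\<close>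

lemma map2_nth_upt:
  assumes "list_all2 (<) is (replicate k m)"
  shows "map2 (!) (replicate k [0..<m]) is = is"
  using assms by (induction k arbitrary: "is") (auto simp: list_all2_Cons2)

lemma subtensor_full:
  assumes "T \<in> cubical_tensors k m"
  shows "subtensor (replicate k [0..<m]) T = T"
proof
  fix "is"
  show "subtensor (replicate k [0..<m]) T is = T is"
    using assms by (auto simp: subtensor_def cubical_tensors_def tensor_indices_def domIff map2_nth_upt)
qed

lemma surviving_indices_none: "surviving_indices k m (\<lambda>_. False) = replicate k [0..<m]"
  by (simp add: surviving_indices_def map_replicate_const)

text \<open>A trace of full size has lost nothing: its domain contains the corner
  \<open>replicate k (m - 1)\<close>, so every dimension retains all of its \<open>m\<close>
  indices. Complete traces can therefore be recognised without knowing \<open>T\<close>.\<close>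

lemma cubical_subtensor_full:
  assumes T: "T \<in> cubical_tensors k m" and "m > 0"
    and X: "subtensor (surviving_indices k m D) T \<in> cubical_tensors k m"
  shows "subtensor (surviving_indices k m D) T = T"
proof -
  let ?ss = "surviving_indices k m D"
  have "replicate k (m - 1) \<in> tensor_indices (replicate k m)"
    using \<open>m > 0\<close> by (auto simp: tensor_indices_def list_all2_conv_all_nth)
  also have "\<dots> = dom (subtensor ?ss T)" using X by (simp add: cubical_tensors_def)
  also have "\<dots> \<subseteq> tensor_indices (map length ?ss)" by (auto simp: subtensor_def split: if_splits)
  finally have "list_all2 (<) (replicate k (m - 1)) (map length ?ss)" by (simp add: tensor_indices_def)
  hence len: "m - 1 < length (filter (\<lambda>i. \<not> D (j, i)) [0..<m])" if "j < k" for j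
    using that by (auto simp: list_all2_conv_all_nth surviving_indices_def)
  have "filter (\<lambda>i. \<not> D (j, i)) [0..<m] = [0..<m]" if "j < k" for j
  proof -
    have "length (filter (\<lambda>i. \<not> D (j, i)) [0..<m]) = length [0..<m]"
      using len[OF that] length_filter_le[of "\<lambda>i. \<not> D (j, i)" "[0..<m]"] by simp
    thus ?thesis by (metis length_filter_less filter_True less_irrefl)
  qed
  hence "?ss = replicate k [0..<m]"
    unfolding surviving_indices_def by (intro nth_equalityI) auto
  thus ?thesis using subtensor_full[OF T] by simp
qed

text \<open>The single outcome in which no slice is deleted already reproduces
  \<open>T\<close>.\<close>

lemma pmf_channel_ge:
  assumes "0 \<le> p" "p \<le> 1" "T \<in> cubical_tensors k m"
  shows "(1 - p) ^ (k * m) \<le> pmf (tensor_deletion_channel k m p T) T"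
proof -
  let ?P = "Pi_pmf ({..<k} \<times> {..<m}) False (\<lambda>_. bernoulli_pmf p)"
  have "(1 - p) ^ (k * m) = pmf ?P (\<lambda>_. False)"
    using assms(1,2) by (simp add: pmf_Pi')
  also have "\<dots> = measure_pmf.prob ?P {\<lambda>_. False}" by (simp add: measure_pmf_single)
  also have "\<dots> \<le> measure_pmf.prob ?P ((\<lambda>D. subtensor (surviving_indices k m D) T) -` {T})"
    by (intro measure_pmf.finite_measure_mono)
      (auto simp: surviving_indices_none subtensor_full[OF assms(3)])
  finally show ?thesis by (simp add: tensor_deletion_channel_def pmf_map)
qed

lemma prob_replicate_pmf_avoids:
  "measure_pmf.prob (replicate_pmf N D) {Xs. x \<notin> set Xs} = (1 - pmf D x) ^ N"
proof (induction N)
  case (Suc N)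
  have "emeasure (measure_pmf (replicate_pmf (Suc N) D)) {Xs. x \<notin> set Xs}
      = (\<integral>\<^sup>+y. emeasure (measure_pmf (replicate_pmf N D \<bind> (\<lambda>ys. return_pmf (y # ys)))) {Xs. x \<notin> set Xs} \<partial>measure_pmf D)"
    unfolding replicate_pmf.simps by (rule emeasure_bind_pmf)
  also have "\<dots> = (\<integral>\<^sup>+y. indicator (- {x}) y * emeasure (measure_pmf (replicate_pmf N D)) {Xs. x \<notin> set Xs} \<partial>measure_pmf D)"
  proof (intro nn_integral_cong)
    fix y
    have "emeasure (measure_pmf (replicate_pmf N D \<bind> (\<lambda>ys. return_pmf (y # ys)))) {Xs. x \<notin> set Xs}
        = emeasure (measure_pmf (replicate_pmf N D)) ((#) y -` {Xs. x \<notin> set Xs})"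
      by (simp add: map_pmf_def[symmetric])
    also have "(#) y -` {Xs. x \<notin> set Xs} = (if y = x then {} else {Xs. x \<notin> set Xs})" by auto
    finally show "emeasure (measure_pmf (replicate_pmf N D \<bind> (\<lambda>ys. return_pmf (y # ys)))) {Xs. x \<notin> set Xs}
        = indicator (- {x}) y * emeasure (measure_pmf (replicate_pmf N D)) {Xs. x \<notin> set Xs}"
      by (auto simp: indicator_def)
  qed
  also have "\<dots> = emeasure (measure_pmf D) (- {x}) * emeasure (measure_pmf (replicate_pmf N D)) {Xs. x \<notin> set Xs}"
    by (subst nn_integral_multc) auto
  also have "emeasure (measure_pmf D) (- {x}) = ennreal (1 - pmf D x)"
    using measure_pmf.prob_compl[of "{x}" D]
    by (simp add: measure_pmf.emeasure_eq_measure measure_pmf_single Compl_eq_Diff_UNIV)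
  finally show ?case
    by (simp add: Suc measure_pmf.emeasure_eq_measure ennreal_mult[symmetric] pmf_le_1)
qed simp

text \<open>The rule returns some trace that is a full cube. Such a trace can only be
  \<open>T\<close>, so the rule errs only if \<open>T\<close> does not occur among the
  \<open>N\<close> traces.\<close>

lemma traces_suffice_if_full_trace:
  assumes "0 \<le> p" "p \<le> 1" "m > 0" and \<delta>: "(1 - (1 - p) ^ (k * m)) ^ N \<le> \<delta>"
  shows "traces_suffice k m p N \<delta>"
  unfolding traces_suffice_def
proof (intro exI ballI)
  let ?R = "\<lambda>Xs. SOME X. X \<in> set Xs \<and> X \<in> (cubical_tensors k m :: bool tensor set)"
  fix T :: "bool tensor" assume T: "T \<in> cubical_tensors k m"
  let ?D = "tensor_deletion_channel k m p T"
  let ?P = "measure_pmf.prob (replicate_pmf N ?D)"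
  have "?P {Xs. T \<notin> set Xs} = (1 - pmf ?D T) ^ N" by (rule prob_replicate_pmf_avoids)
  also have "\<dots> \<le> (1 - (1 - p) ^ (k * m)) ^ N"
    using pmf_channel_ge[OF assms(1,2) T] by (intro power_mono) (auto simp: pmf_le_1)
  finally have "?P {Xs. T \<notin> set Xs} \<le> \<delta>" using \<delta> by simp
  moreover have "?P (- {Xs. T \<notin> set Xs}) = 1 - ?P {Xs. T \<notin> set Xs}"
    using measure_pmf.prob_compl[of "{Xs. T \<notin> set Xs}" "replicate_pmf N ?D"]
    by (simp add: Compl_eq_Diff_UNIV)
  moreover have "?P (- {Xs. T \<notin> set Xs}) \<le> ?P {Xs. ?R Xs = T}"
  proof (intro measure_pmf.finite_measure_mono_AE)
    show "AE Xs in replicate_pmf N ?D. Xs \<in> - {Xs. T \<notin> set Xs} \<longrightarrow> Xs \<in> {Xs. ?R Xs = T}"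
      unfolding AE_measure_pmf_iff
    proof (intro ballI impI)
      fix Xs assume Xs: "Xs \<in> set_pmf (replicate_pmf N ?D)" "Xs \<in> - {Xs. T \<notin> set Xs}"
      have "X = T" if X: "X \<in> set Xs" "X \<in> cubical_tensors k m" for X
      proof -
        have "X \<in> set_pmf ?D" using Xs X by (auto simp: set_replicate_pmf)
        then obtain D where D: "X = subtensor (surviving_indices k m D) T"
          by (auto simp: tensor_deletion_channel_def)
        show ?thesis using cubical_subtensor_full[OF T \<open>m > 0\<close>] X(2) unfolding D by blast
      qed
      moreover have "T \<in> set Xs" using Xs(2) by simp
      ultimately have "?R Xs = T" using T by (intro some_equality) blast+
      thus "Xs \<in> {Xs. ?R Xs = T}" by simp
    qed
  qed auto
  ultimately show "?P {Xs. ?R Xs = T} \<ge> 1 - \<delta>" by simp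
qed

section \<open>The generating polynomial of a trace and its expectation\<close>

lemma monomial_eq_prod:
  assumes "length zs = length is"
  shows "monomial zs is = (\<Prod>j<length is. (zs ! j) ^ (is ! j))"
  using assms by (induction zs "is" rule: list_induct2) (simp_all add: prod.lessThan_Suc_shift del: prod.lessThan_Suc)

lemma length_tensor_indices: "is \<in> tensor_indices ds \<Longrightarrow> length is = length ds"
  by (auto simp: tensor_indices_def dest: list_all2_lengthD)

lemma nth_tensor_indices: "is \<in> tensor_indices ds \<Longrightarrow> j < length ds \<Longrightarrow> is ! j < ds ! j"
  by (auto simp: tensor_indices_def list_all2_conv_all_nth)

text \<open>A retained index \<open>a\<close> sits in the filtered list at the position given by the
  number of retained indices below \<open>a\<close>. Summing over positions thus becomes summing
  over original indices, a range that does not depend on \<open>P\<close>.\<close>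

lemma sum_filter_upt:
  fixes F :: "nat \<Rightarrow> nat \<Rightarrow> 'a::comm_monoid_add"
  shows "(\<Sum>i<length (filter P [0..<m]). F (filter P [0..<m] ! i) i)
    = (\<Sum>a<m. if P a then F a (card {i. i < a \<and> P i}) else 0)"
proof (induction m)
  case (Suc m)
  have "length (filter P [0..<m]) = card {i. i < m \<and> P i}"
    by (auto simp: length_filter_conv_card intro!: arg_cong[of _ _ card])
  thus ?case using Suc by (simp add: nth_append)
qed simp

text \<open>\<open>sum_filter_upt\<close> is applied to one dimension at a time. \<open>G\<close> is
  generalised in the induction so that it can absorb the leading index.\<close>

lemma sum_survivors:
  fixes G :: "nat list \<Rightarrow> 'a::comm_semiring_1"
  assumes "length Ps = length ws"
  shows "(\<Sum>is\<in>tensor_indices (map (\<lambda>P. length (filter P [0..<m])) Ps).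
      G (map2 (!) (map (\<lambda>P. filter P [0..<m]) Ps) is) * monomial ws is)
    = (\<Sum>js\<in>tensor_indices (replicate (length Ps) m). G js *
      (\<Prod>j<length Ps. if (Ps ! j) (js ! j) then ws ! j ^ card {i. i < js ! j \<and> (Ps ! j) i} else 0))"
  using assms
proof (induction Ps ws arbitrary: G rule: list_induct2)
  case (Cons P Ps w ws)
  let ?f = "filter P [0..<m]"
  let ?I = "tensor_indices (map (\<lambda>P. length (filter P [0..<m])) Ps)"
  let ?J = "tensor_indices (replicate (length Ps) m)"
  let ?pr = "\<lambda>js. \<Prod>j<length Ps. if (Ps ! j) (js ! j) then ws ! j ^ card {i. i < js ! j \<and> (Ps ! j) i} else 0"
  have "(\<Sum>is\<in>tensor_indices (map (\<lambda>P. length (filter P [0..<m])) (P # Ps)).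
      G (map2 (!) (map (\<lambda>P. filter P [0..<m]) (P # Ps)) is) * monomial (w # ws) is)
    = (\<Sum>i<length ?f. \<Sum>is\<in>?I. w ^ i * (G (?f ! i # map2 (!) (map (\<lambda>P. filter P [0..<m]) Ps) is) * monomial ws is))"
    by (simp add: sum_tensor_indices_Cons mult_ac)
  also have "\<dots> = (\<Sum>i<length ?f. w ^ i * (\<Sum>js\<in>?J. G (?f ! i # js) * ?pr js))"
    unfolding sum_distrib_left[symmetric] using Cons.IH[of "\<lambda>js. G (_ # js)"] by simp
  also have "\<dots> = (\<Sum>a<m. if P a then w ^ card {i. i < a \<and> P i} * (\<Sum>js\<in>?J. G (a # js) * ?pr js) else 0)"
    by (rule sum_filter_upt)
  also have "\<dots> = (\<Sum>a<m. \<Sum>js\<in>?J. G (a # js) * ((if P a then w ^ card {i. i < a \<and> P i} else 0) * ?pr js))"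
    by (intro sum.cong refl) (simp add: sum_distrib_left mult_ac)
  also have "\<dots> = (\<Sum>js\<in>tensor_indices (replicate (length (P # Ps)) m). G js *
      (\<Prod>j<length (P # Ps). if ((P # Ps) ! j) (js ! j)
        then (w # ws) ! j ^ card {i. i < js ! j \<and> ((P # Ps) ! j) i} else 0))"
    by (simp only: length_Cons replicate_Suc sum_tensor_indices_Cons prod.lessThan_Suc_shift)
       (simp cong: if_cong)
  finally show ?case .
qed simp

text \<open>The generating polynomial of the trace at \<open>ws\<close>. Summing over the full box
  with \<open>None\<close> counted as 0 pads the trace with zeros, so neither the definition nor the
  bound on its modulus refers to the shape of the trace.\<close>

definition trace_statistic :: "nat \<Rightarrow> nat \<Rightarrow> complex list \<Rightarrow> bool tensor \<Rightarrow> complex" where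
  "trace_statistic k m ws X =
     (\<Sum>is\<in>tensor_indices (replicate k m). (if X is = Some True then 1 else 0) * monomial ws is)"

text \<open>Rewriting the sum over the original indices leaves the randomness only in the products,
  so that expectations can be taken term by term.\<close>

lemma trace_statistic_subtensor:
  assumes ws: "length ws = k"
  shows "trace_statistic k m ws (subtensor (surviving_indices k m D) T)
    = (\<Sum>js\<in>tensor_indices (replicate k m). (if T js = Some True then 1 else 0) *
      (\<Prod>j<k. if \<not> D (j, js ! j) then ws ! j ^ card {i. i < js ! j \<and> \<not> D (j, i)} else 0))"
proof -
  define Ps where "Ps = map (\<lambda>j i. \<not> D (j, i)) [0..<k]"
  let ?ss = "map (\<lambda>P. filter P [0..<m]) Ps"
  let ?I = "tensor_indices (map length ?ss)"
  have ss: "surviving_indices k m D = ?ss" by (simp add: surviving_indices_def Ps_def)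
  have len: "length Ps = k" by (simp add: Ps_def)
  have sub: "?I \<subseteq> tensor_indices (replicate k m)"
  proof
    fix "is" assume "is \<in> ?I"
    hence "is ! j < length (filter (Ps ! j) [0..<m])" if "j < k" for j
      using that nth_tensor_indices[OF \<open>is \<in> ?I\<close>, of j] by (simp add: len)
    moreover have "length (filter (Ps ! j) [0..<m]) \<le> m" for j
      using length_filter_le[of "Ps ! j" "[0..<m]"] by simp
    moreover have "length is = k" using length_tensor_indices[OF \<open>is \<in> ?I\<close>] by (simp add: len)
    ultimately show "is \<in> tensor_indices (replicate k m)"
      by (fastforce simp: tensor_indices_def list_all2_conv_all_nth intro: less_le_trans)
  qed
  have "trace_statistic k m ws (subtensor ?ss T)
    = (\<Sum>is\<in>?I. (if subtensor ?ss T is = Some True then 1 else 0) * monomial ws is)"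
    unfolding trace_statistic_def
    by (rule sum.mono_neutral_right) (use sub in \<open>auto simp: subtensor_def\<close>)
  also have "\<dots> = (\<Sum>is\<in>?I. (if T (map2 (!) ?ss is) = Some True then 1 else 0) * monomial ws is)"
    by (intro sum.cong) (auto simp: subtensor_def)
  also have "\<dots> = (\<Sum>js\<in>tensor_indices (replicate k m). (if T js = Some True then 1 else 0) *
      (\<Prod>j<k. if (Ps ! j) (js ! j) then ws ! j ^ card {i. i < js ! j \<and> (Ps ! j) i} else 0))"
    using sum_survivors[of Ps ws "\<lambda>js. if T js = Some True then 1 else 0" m] ws
    by (simp add: len o_def)
  also have "\<dots> = (\<Sum>js\<in>tensor_indices (replicate k m). (if T js = Some True then 1 else 0) *
      (\<Prod>j<k. if \<not> D (j, js ! j) then ws ! j ^ card {i. i < js ! j \<and> \<not> D (j, i)} else 0))"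
    by (intro sum.cong prod.cong arg_cong2[of _ _ _ _ "(*)"] refl) (simp add: Ps_def)
  finally show ?thesis unfolding ss .
qed

lemma prod_marker:
  fixes f :: "nat \<Rightarrow> 'a::comm_monoid_mult"
  assumes "a < m"
  shows "(\<Prod>i<m. if i < a then f i else if i = a then c else 1) = (\<Prod>i<a. f i) * c"
proof -
  have "(\<Prod>i<m. if i < a then f i else if i = a then c else 1)
      = (\<Prod>i<Suc a. if i < a then f i else if i = a then c else 1)"
    by (rule prod.mono_neutral_right) (use assms in auto)
  thus ?thesis by simp
qed

lemma integral_bernoulli_pmf_complex:
  fixes f :: "bool \<Rightarrow> complex"
  assumes "0 \<le> p" "p \<le> 1"
  shows "measure_pmf.expectation (bernoulli_pmf p) f = p * f True + (1 - p) * f False"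
  using assms by (subst integral_measure_pmf[of UNIV]) (auto simp: UNIV_bool scaleR_conv_of_real)

lemma finite_set_Pi_bernoulli:
  "finite A \<Longrightarrow> finite (set_pmf (Pi_pmf A False (\<lambda>_. bernoulli_pmf p)))"
  by (subst set_Pi_pmf) (auto intro!: finite_PiE_dflt)

text \<open>The product splits into independent factors, one per slice. In dimension
  \<open>j\<close>, a slice below \<open>js ! j\<close> contributes 1 if deleted and
  \<open>ws ! j\<close> if kept, hence \<open>p + (1 - p) * ws ! j\<close> on average; the slice
  \<open>js ! j\<close> has to survive, which gives \<open>1 - p\<close>; later slices contribute
  1.\<close>

lemma expectation_slices:
  fixes p :: real and ws :: "complex list"
  assumes p: "0 \<le> p" "p \<le> 1" and ws: "length ws = k" and js: "js \<in> tensor_indices (replicate k m)"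
  shows "measure_pmf.expectation (Pi_pmf ({..<k} \<times> {..<m}) False (\<lambda>_. bernoulli_pmf p))
      (\<lambda>D. \<Prod>j<k. if \<not> D (j, js ! j) then ws ! j ^ card {i. i < js ! j \<and> \<not> D (j, i)} else 0)
    = of_real ((1 - p) ^ k) * monomial (map (\<lambda>w. p + (1 - p) * w) ws) js"
proof -
  \<comment> \<open>The flag \<open>d\<close> says whether the slice is deleted.\<close>
  define h :: "nat \<times> nat \<Rightarrow> bool \<Rightarrow> complex" where
    "h = (\<lambda>(j, i) d. if i < js ! j then if d then 1 else ws ! j else if i = js ! j then if d then 0 else 1 else 1)"
  have lt: "js ! j < m" if "j < k" for j using nth_tensor_indices[OF js] that by auto
  have "(\<Prod>j<k. if \<not> D (j, js ! j) then ws ! j ^ card {i. i < js ! j \<and> \<not> D (j, i)} else 0)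
      = (\<Prod>x\<in>{..<k} \<times> {..<m}. h x (D x))" for D
  proof -
    have "(if \<not> D (j, js ! j) then ws ! j ^ card {i. i < js ! j \<and> \<not> D (j, i)} else 0)
        = (\<Prod>i<m. h (j, i) (D (j, i)))" if "j < k" for j
    proof -
      have "(\<Prod>i<m. h (j, i) (D (j, i))) = (\<Prod>i<m. if i < js ! j then if D (j, i) then 1 else ws ! j
          else if i = js ! j then if D (j, js ! j) then 0 else 1 else 1)"
        by (intro prod.cong) (auto simp: h_def)
      also have "\<dots> = (\<Prod>i<js ! j. if D (j, i) then 1 else ws ! j) * (if D (j, js ! j) then 0 else 1)"
        by (rule prod_marker[OF lt[OF that]])
      also have "(\<Prod>i<js ! j. if D (j, i) then 1 else ws ! j) = ws ! j ^ card {i. i < js ! j \<and> \<not> D (j, i)}"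
      proof -
        have "{..<js ! j} \<inter> - {i. D (j, i)} = {i. i < js ! j \<and> \<not> D (j, i)}" by auto
        thus ?thesis by (simp add: prod.If_cases)
      qed
      finally show ?thesis by simp
    qed
    thus ?thesis by (simp add: prod.cartesian_product)
  qed
  hence "measure_pmf.expectation (Pi_pmf ({..<k} \<times> {..<m}) False (\<lambda>_. bernoulli_pmf p))
      (\<lambda>D. \<Prod>j<k. if \<not> D (j, js ! j) then ws ! j ^ card {i. i < js ! j \<and> \<not> D (j, i)} else 0)
    = (\<Prod>x\<in>{..<k} \<times> {..<m}. measure_pmf.expectation (bernoulli_pmf p) (h x))"
    by (simp add: expectation_prod_Pi_pmf_finite)
  also have "\<dots> = (\<Prod>j<k. \<Prod>i<m. measure_pmf.expectation (bernoulli_pmf p) (h (j, i)))"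
    by (simp add: prod.cartesian_product)
  also have "\<dots> = (\<Prod>j<k. (p + (1 - p) * ws ! j) ^ (js ! j) * (1 - p))"
  proof (intro prod.cong refl)
    fix j assume "j \<in> {..<k}"
    hence j: "js ! j < m" using lt by simp
    have "(\<Prod>i<m. measure_pmf.expectation (bernoulli_pmf p) (h (j, i)))
        = (\<Prod>i<m. if i < js ! j then p + (1 - p) * ws ! j else if i = js ! j then of_real (1 - p) else 1)"
      by (intro prod.cong refl) (auto simp: integral_bernoulli_pmf_complex[OF p] h_def)
    also have "\<dots> = (p + (1 - p) * ws ! j) ^ (js ! j) * (1 - p)"
      using prod_marker[OF j, of "\<lambda>_. p + (1 - p) * ws ! j" "of_real (1 - p)"] by simp
    finally show "(\<Prod>i<m. measure_pmf.expectation (bernoulli_pmf p) (h (j, i)))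
        = (p + (1 - p) * ws ! j) ^ (js ! j) * (1 - p)" .
  qed
  also have "\<dots> = of_real ((1 - p) ^ k) * monomial (map (\<lambda>w. p + (1 - p) * w) ws) js"
    using length_tensor_indices[OF js] ws by (simp add: monomial_eq_prod prod.distrib)
  finally show ?thesis .
qed

lemma expectation_trace_statistic:
  fixes p :: real and ws :: "complex list"
  assumes p: "0 \<le> p" "p \<le> 1" and ws: "length ws = k"
  shows "measure_pmf.expectation (tensor_deletion_channel k m p T) (trace_statistic k m ws)
    = of_real ((1 - p) ^ k) * (\<Sum>js\<in>tensor_indices (replicate k m).
      (if T js = Some True then 1 else 0) * monomial (map (\<lambda>w. p + (1 - p) * w) ws) js)"
proof -
  let ?P = "Pi_pmf ({..<k} \<times> {..<m}) False (\<lambda>_. bernoulli_pmf p)"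
  have int: "integrable (measure_pmf ?P) f" for f :: "_ \<Rightarrow> complex"
    by (intro integrable_measure_pmf_finite finite_set_Pi_bernoulli) auto
  have "measure_pmf.expectation (tensor_deletion_channel k m p T) (trace_statistic k m ws)
    = (\<Sum>js\<in>tensor_indices (replicate k m). (if T js = Some True then 1 else 0) *
        measure_pmf.expectation ?P
          (\<lambda>D. \<Prod>j<k. if \<not> D (j, js ! j) then ws ! j ^ card {i. i < js ! j \<and> \<not> D (j, i)} else 0))"
    unfolding tensor_deletion_channel_def integral_map_pmf trace_statistic_subtensor[OF ws]
    by (subst Bochner_Integration.integral_sum) (auto intro: int)
  also have "\<dots> = of_real ((1 - p) ^ k) * (\<Sum>js\<in>tensor_indices (replicate k m).
      (if T js = Some True then 1 else 0) * monomial (map (\<lambda>w. p + (1 - p) * w) ws) js)"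
    unfolding sum_distrib_left
    by (intro sum.cong refl) (simp add: expectation_slices[OF p ws])
  finally show ?thesis .
qed

lemma finite_set_channel: "finite (set_pmf (tensor_deletion_channel k m p T))"
  by (simp add: tensor_deletion_channel_def finite_set_Pi_bernoulli)

section \<open>Littlewood-type polynomials on short arcs\<close>

text \<open>The \<open>L\<close>-th roots of unity are spaced by the angle
  \<open>2 * pi / L\<close>, so one of the rotations brings any point to within half a spacing of
  1.\<close>

lemma cis_rotation_into_arc:
  fixes t :: real and L :: nat
  assumes "L \<ge> 1"
  obtains j \<theta> where "j < L" "\<bar>\<theta>\<bar> \<le> pi / L" "cis t * cis (2 * pi * j / L) = cis \<theta>"
proof -
  \<comment> \<open>Nearest number of spacings, with reversed sign; reducing it modulo
    \<open>L\<close> changes the angle only by full turns.\<close>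
  define i :: int where "i = - round (t * L / (2 * pi))"
  define j where "j = nat (i mod int L)"
  define \<theta> where "\<theta> = t + 2 * pi * i / L"
  have L: "real L > 0" using assms by simp
  have j: "j < L" "int j = i mod int L"
    using assms by (auto simp: j_def nat_less_iff)
  have "\<bar>t * L / (2 * pi) + i\<bar> \<le> 1 / 2"
    using of_int_round_abs_le[of "t * L / (2 * pi)"] unfolding i_def by (simp add: abs_minus_commute)
  moreover have "\<theta> = (t * L / (2 * pi) + i) * (2 * pi / L)"
    using L by (simp add: \<theta>_def field_simps)
  ultimately have "\<bar>\<theta>\<bar> \<le> 1 / 2 * (2 * pi / L)"
    by (simp only: abs_mult) (intro mult_mono, auto)
  hence bound: "\<bar>\<theta>\<bar> \<le> pi / L" by simp
  have "i = int L * (i div int L) + int j" using j by simp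
  hence i: "real_of_int i = L * real_of_int (i div int L) + j"
    by (metis of_int_add of_int_mult of_int_of_nat_eq)
  have "\<theta> = t + 2 * pi * j / L + 2 * pi * of_int (i div int L)"
    unfolding \<theta>_def i using L by (simp add: field_simps)
  hence "cis \<theta> = cis t * cis (2 * pi * j / L) * cis (2 * pi * of_int (i div int L))"
    by (simp only: cis_mult)
  also have "cis (2 * pi * of_int (i div int L)) = 1"
    by (rule cis_multiple_2pi) auto
  finally show thesis using that j(1) bound by simp
qed

text \<open>The product of the rotations of \<open>f\<close> by the \<open>L\<close>-th roots of unity has modulus at least
  \<open>(norm (f 0))^L\<close> somewhere on the unit circle, and one of its factors is evaluated on the arc.\<close>

lemma large_on_short_arc:
  fixes f :: "complex \<Rightarrow> complex" and L :: nat
  assumes L: "L \<ge> 1" and hol: "f holomorphic_on UNIV"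
    and H: "\<And>z. norm z = 1 \<Longrightarrow> norm (f z) \<le> H"
  obtains \<theta> where "\<bar>\<theta>\<bar> \<le> pi / L" "norm (f 0) ^ L \<le> norm (f (cis \<theta>)) * H ^ (L - 1)"
proof -
  define \<omega> where "\<omega> = (\<lambda>j::nat. cis (2 * pi * j / L))"
  define F where "F = (\<lambda>z. \<Prod>j<L. f (z * \<omega> j))"
  have hol': "(\<lambda>z. f (z * \<omega> j)) holomorphic_on UNIV" for j
  proof -
    have "(f \<circ> (\<lambda>z. z * \<omega> j)) holomorphic_on UNIV"
      by (intro holomorphic_on_compose holomorphic_intros holomorphic_on_subset[OF hol]) auto
    thus ?thesis by (simp add: o_def)
  qed
  have holF: "F holomorphic_on UNIV"
    unfolding F_def by (intro holomorphic_on_prod hol')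
  have contF: "continuous_on X F" for X
    using holF holomorphic_on_imp_continuous_on continuous_on_subset by blast
  have "\<exists>x\<in>sphere 0 1. \<forall>y\<in>sphere 0 1. norm (F y) \<le> norm (F x)"
    by (rule continuous_attains_sup) (auto intro!: continuous_intros contF)
  then obtain x where x: "norm x = 1" "\<And>y. norm y = 1 \<Longrightarrow> norm (F y) \<le> norm (F x)"
    by auto
  \<comment> \<open>The maximum modulus principle on the closed unit disc; \<open>x\<close> is a
    maximiser on the circle.\<close>
  have "norm (F 0) \<le> norm (F x)"
  proof (rule maximum_modulus_frontier[of F "cball 0 1"])
    show "F holomorphic_on interior (cball 0 1)" using holF holomorphic_on_subset by blast
  qed (use x contF in auto)
  moreover have "norm (F 0) = norm (f 0) ^ L" by (simp add: F_def norm_power)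
  ultimately have ge: "norm (f 0) ^ L \<le> norm (F x)" by simp
  obtain t where t: "x = cis t" using x(1) by (metis cis_Arg norm_eq_zero sgn_eq div_by_1 of_real_1 zero_neq_one)
  obtain j \<theta> where j: "j < L" "\<bar>\<theta>\<bar> \<le> pi / L" "cis t * cis (2 * pi * j / L) = cis \<theta>"
    using cis_rotation_into_arc[OF L] by blast
  \<comment> \<open>The factor that lands on the arc is kept, and the other \<open>L - 1\<close>
    factors are bounded by \<open>H\<close>.\<close>
  have "norm (F x) = norm (f (x * \<omega> j)) * (\<Prod>i\<in>{..<L} - {j}. norm (f (x * \<omega> i)))"
    unfolding F_def prod_norm[symmetric] using j(1) by (subst prod.remove[of _ j]) auto
  also have "(\<Prod>i\<in>{..<L} - {j}. norm (f (x * \<omega> i))) \<le> (\<Prod>i\<in>{..<L} - {j}. H)"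
    by (intro prod_mono) (auto intro!: H simp: norm_mult x \<omega>_def)
  also have "\<dots> = H ^ (L - 1)" using j(1) by simp
  also have "f (x * \<omega> j) = f (cis \<theta>)" using j(3) by (simp add: t \<omega>_def)
  finally have "norm (F x) \<le> norm (f (cis \<theta>)) * H ^ (L - 1)" by (simp add: mult_left_mono)
  thus thesis using that[OF j(2)] ge by linarith
qed

text \<open>Fixing all variables but the first, the product of rotations is compared with the coefficient of
  the lowest occurring power of the first variable, to which the induction hypothesis applies.\<close>

lemma multivariate_large_on_short_arcs:
  fixes c :: "nat list \<Rightarrow> complex" and L :: nat
  assumes L: "L \<ge> 1" and "is0 \<in> tensor_indices ds" "c is0 \<noteq> 0"
    and "\<And>is. is \<in> tensor_indices ds \<Longrightarrow> c is \<noteq> 0 \<Longrightarrow> norm (c is) \<ge> 1"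
    and "(\<Sum>is\<in>tensor_indices ds. norm (c is)) \<le> H"
  shows "\<exists>\<theta>s. length \<theta>s = length ds \<and> (\<forall>\<theta>\<in>set \<theta>s. \<bar>\<theta>\<bar> \<le> pi / L) \<and>
    1 \<le> norm (\<Sum>is\<in>tensor_indices ds. c is * monomial (map cis \<theta>s) is) * H ^ (L ^ length ds - 1)"
  using assms(2-)
proof (induction ds arbitrary: c is0)
  case Nil
  thus ?case by auto
next
  case (Cons m ds)
  let ?K = "tensor_indices ds"
  define P where "P = (\<lambda>i. \<exists>is\<in>?K. c (i # is) \<noteq> 0)"
  obtain i0 is1 where "is0 = i0 # is1" "i0 < m" "is1 \<in> ?K"
    using Cons.prems(1) by (auto simp: tensor_indices_Cons)
  hence i0: "P i0" "i0 < m" using Cons.prems(2) by (auto simp: P_def)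
  define a where "a = (LEAST i. P i)"
  have a: "P a" "a \<le> i0" "\<And>i. i < a \<Longrightarrow> \<not> P i"
    unfolding a_def using i0(1) by (auto intro: LeastI Least_le dest: not_less_Least)
  hence am: "a < m" using i0 by simp
  obtain is2 where is2: "is2 \<in> ?K" "c (a # is2) \<noteq> 0" using a(1) by (auto simp: P_def)
  have sumH: "(\<Sum>i<m. \<Sum>is\<in>?K. norm (c (i # is))) \<le> H"
    using Cons.prems(4) by (simp add: sum_tensor_indices_Cons)
  have "(\<Sum>is\<in>?K. norm (c (a # is))) \<le> (\<Sum>i<m. \<Sum>is\<in>?K. norm (c (i # is)))"
    using am by (intro member_le_sum[of a "{..<m}" "\<lambda>i. \<Sum>is\<in>?K. norm (c (i # is))"])
      (auto intro!: sum_nonneg)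
  with sumH have sumaH: "(\<Sum>is\<in>?K. norm (c (a # is))) \<le> H" by simp
  have "1 \<le> norm (c (a # is2))"
    using Cons.prems(3)[of "a # is2"] is2 am by (auto simp: tensor_indices_Cons)
  also have "\<dots> \<le> (\<Sum>is\<in>?K. norm (c (a # is)))" using is2 by (intro member_le_sum) auto
  finally have H1: "H \<ge> 1" using sumaH by simp
  \<comment> \<open>The angles of the remaining variables are fixed first, from the coefficients
    with leading index \<open>a\<close>; the first angle is chosen afterwards and depends on
    them.\<close>
  have "\<exists>\<theta>s. length \<theta>s = length ds \<and> (\<forall>\<theta>\<in>set \<theta>s. \<bar>\<theta>\<bar> \<le> pi / L) \<and>
    1 \<le> norm (\<Sum>is\<in>?K. c (a # is) * monomial (map cis \<theta>s) is) * H ^ (L ^ length ds - 1)"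
    by (rule Cons.IH[of is2 "\<lambda>is. c (a # is)"]) (use is2 Cons.prems(3) am sumaH in \<open>auto simp: tensor_indices_Cons\<close>)
  then obtain \<theta>s where \<theta>s: "length \<theta>s = length ds" "\<forall>\<theta>\<in>set \<theta>s. \<bar>\<theta>\<bar> \<le> pi / L"
    "1 \<le> norm (\<Sum>is\<in>?K. c (a # is) * monomial (map cis \<theta>s) is) * H ^ (L ^ length ds - 1)"
    by blast
  define u where "u = (\<lambda>i. \<Sum>is\<in>?K. c (i # is) * monomial (map cis \<theta>s) is)"
  have u0: "u i = 0" if "i < a" for i
    using a(3)[OF that] unfolding u_def P_def by (intro sum.neutral) auto
  have u_le: "norm (u i) \<le> (\<Sum>is\<in>?K. norm (c (i # is)))" for i
    unfolding u_def by (intro sum_norm_le) (simp add: norm_mult norm_monomial_eq_1)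
  \<comment> \<open>Dividing by \<open>z ^ a\<close> preserves the modulus on the unit circle and
    moves \<open>u a\<close> to the constant term, where the one-variable bound uses it.\<close>
  define f where "f = (\<lambda>z::complex. \<Sum>i=a..<m. u i * z ^ (i - a))"
  have shift: "z ^ a * f z = (\<Sum>i<m. u i * z ^ i)" for z
  proof -
    have "z ^ a * f z = (\<Sum>i=a..<m. u i * z ^ i)"
      unfolding f_def sum_distrib_left by (intro sum.cong) (auto simp: power_add[symmetric])
    also have "\<dots> = (\<Sum>i<m. u i * z ^ i)"
      by (rule sum.mono_neutral_left) (auto simp: u0)
    finally show ?thesis .
  qed
  have f_le: "norm (f z) \<le> H" if "norm z = 1" for z
  proof -
    have "norm (f z) = norm (z ^ a * f z)" using that by (simp add: norm_mult norm_power)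
    also have "\<dots> \<le> (\<Sum>i<m. \<Sum>is\<in>?K. norm (c (i # is)))"
      unfolding shift by (intro sum_norm_le) (use u_le in \<open>simp add: norm_mult norm_power that\<close>)
    finally show ?thesis using sumH by simp
  qed
  have hol: "f holomorphic_on UNIV" unfolding f_def by (intro holomorphic_intros)
  obtain \<theta> where \<theta>: "\<bar>\<theta>\<bar> \<le> pi / L" "norm (f 0) ^ L \<le> norm (f (cis \<theta>)) * H ^ (L - 1)"
    using large_on_short_arc[OF L hol f_le] by blast
  have f0: "f 0 = u a"
  proof -
    have "f 0 = (\<Sum>i\<in>{a}. u i * 0 ^ (i - a))"
      unfolding f_def by (rule sum.mono_neutral_right) (use am in auto)
    thus ?thesis by simp
  qed
  have eq: "norm (\<Sum>is\<in>tensor_indices (m # ds). c is * monomial (map cis (\<theta> # \<theta>s)) is) = norm (f (cis \<theta>))"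
  proof -
    have "(\<Sum>is\<in>tensor_indices (m # ds). c is * monomial (map cis (\<theta> # \<theta>s)) is) = cis \<theta> ^ a * f (cis \<theta>)"
      unfolding shift u_def sum_tensor_indices_Cons by (simp add: sum_distrib_left mult_ac)
    thus ?thesis by (simp add: norm_mult norm_power)
  qed
  define e where "e = L ^ length ds - 1"
  \<comment> \<open>The new variable costs \<open>L - 1\<close> powers of \<open>H\<close>, and
    raising the inductive bound to the \<open>L\<close>-th power multiplies its exponent by
    \<open>L\<close>.\<close>
  have e: "L ^ length (m # ds) - 1 = (L - 1) + e * L"
  proof -
    have "L ^ length ds = Suc e" using L by (simp add: e_def)
    thus ?thesis using L by (cases L) simp_all
  qed
  have "1 \<le> (norm (u a) * H ^ e) ^ L"
    using \<theta>s(3) unfolding u_def e_def by (rule one_le_power)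
  also have "\<dots> = norm (f 0) ^ L * H ^ (e * L)" by (simp add: power_mult_distrib f0 power_mult)
  also have "\<dots> \<le> norm (f (cis \<theta>)) * H ^ (L - 1) * H ^ (e * L)"
    using \<theta>(2) H1 by (intro mult_right_mono) auto
  also have "\<dots> = norm (f (cis \<theta>)) * H ^ (L ^ length (m # ds) - 1)"
    unfolding e by (simp add: power_add)
  finally have "1 \<le> norm (\<Sum>is\<in>tensor_indices (m # ds). c is * monomial (map cis (\<theta> # \<theta>s)) is) *
      H ^ (L ^ length (m # ds) - 1)" unfolding eq .
  thus ?case using \<theta>s(1,2) \<theta>(1) by (intro exI[of _ "\<theta> # \<theta>s"]) auto
qed

section \<open>Separating two tensors\<close>

text \<open>The squared modulus of \<open>cis \<theta> - p\<close> is
  \<open>q\<^sup>2 + 2 * p * (1 - cos \<theta>)\<close>. Its excess over \<open>q\<^sup>2\<close> is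
  quadratic in the angle, which is why short arcs keep the statistic small.\<close>

lemma norm_affine_cis_le:
  fixes p q :: real
  assumes p: "0 \<le> p" "p < 1" and q: "q = 1 - p" and \<theta>: "\<bar>\<theta>\<bar> \<le> \<phi>"
  shows "norm ((cis \<theta> - p) / q) \<le> exp (p * \<phi>\<^sup>2 / (2 * q\<^sup>2))"
proof -
  have q0: "q > 0" using p q by simp
  have "1 - cos \<theta> = 2 * (sin (\<theta> / 2))\<^sup>2" using cos_double_sin[of "\<theta> / 2"] by simp
  also have "(sin (\<theta> / 2))\<^sup>2 \<le> (\<theta> / 2)\<^sup>2" using abs_sin_x_le_abs_x by (rule abs_le_square_iff[THEN iffD1])
  also have "2 * (\<theta> / 2)\<^sup>2 = \<theta>\<^sup>2 / 2" by (simp add: power2_eq_square)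
  also have "\<theta>\<^sup>2 \<le> \<phi>\<^sup>2" using \<theta> by (intro abs_le_square_iff[THEN iffD1]) auto
  finally have cos: "2 * (1 - cos \<theta>) \<le> \<phi>\<^sup>2" by simp
  have "(norm (cis \<theta> - p))\<^sup>2 = (cos \<theta> - p)\<^sup>2 + (sin \<theta>)\<^sup>2" by (simp add: cmod_power2)
  also have "\<dots> = q\<^sup>2 + p * (2 * (1 - cos \<theta>))"
    using sin_cos_squared_add[of \<theta>] unfolding q by (simp add: power2_eq_square algebra_simps)
  also have "\<dots> \<le> q\<^sup>2 + p * \<phi>\<^sup>2" using cos p by (intro add_left_mono mult_left_mono) auto
  finally have "(norm (cis \<theta> - p))\<^sup>2 / q\<^sup>2 \<le> (q\<^sup>2 + p * \<phi>\<^sup>2) / q\<^sup>2"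
    using q0 by (intro divide_right_mono) auto
  also have "\<dots> = 1 + p * \<phi>\<^sup>2 / q\<^sup>2" using q0 by (simp add: field_simps)
  also have "\<dots> \<le> exp (p * \<phi>\<^sup>2 / q\<^sup>2)" by (rule exp_ge_add_one_self)
  also have "\<dots> = (exp (p * \<phi>\<^sup>2 / (2 * q\<^sup>2)))\<^sup>2" by (simp add: exp_double[symmetric])
  also have "(norm (cis \<theta> - p))\<^sup>2 / q\<^sup>2 = (norm ((cis \<theta> - p) / q))\<^sup>2"
    using q0 by (simp add: norm_divide power_divide)
  finally show ?thesis by (rule power2_le_imp_le) simp
qed

lemma norm_monomial_le:
  fixes ws :: "complex list"
  assumes "\<forall>w\<in>set ws. norm w \<le> r" "r \<ge> 1" "length ws = k" "is \<in> tensor_indices (replicate k m)"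
  shows "norm (monomial ws is) \<le> (r ^ m) ^ k"
proof -
  have len: "length is = k" using length_tensor_indices[OF assms(4)] by simp
  have "norm (monomial ws is) = (\<Prod>j<k. norm (ws ! j) ^ (is ! j))"
    using assms(3) len by (simp add: monomial_eq_prod prod_norm[symmetric] norm_power)
  also have "\<dots> \<le> (\<Prod>j<k. r ^ m)"
  proof (intro prod_mono conjI)
    fix j assume j: "j \<in> {..<k}"
    have "norm (ws ! j) ^ (is ! j) \<le> r ^ (is ! j)"
      using assms(1,3) j by (intro power_mono) auto
    also have "\<dots> \<le> r ^ m"
      using nth_tensor_indices[OF assms(4), of j] j assms(2) by (intro power_increasing) auto
    finally show "norm (ws ! j) ^ (is ! j) \<le> r ^ m" .
  qed simp
  finally show ?thesis by simp
qed

lemma norm_trace_statistic_le: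
  assumes "\<forall>w\<in>set ws. norm w \<le> r" "r \<ge> 1" "length ws = k"
  shows "norm (trace_statistic k m ws X) \<le> real (m ^ k) * (r ^ m) ^ k"
proof -
  have "norm (trace_statistic k m ws X) \<le> (\<Sum>is\<in>tensor_indices (replicate k m). (r ^ m) ^ k)"
    unfolding trace_statistic_def
    by (intro sum_norm_le) (use norm_monomial_le[OF assms] assms(2) in \<open>auto simp: norm_mult\<close>)
  thus ?thesis by (simp add: card_tensor_indices)
qed

text \<open>The difference of the two generating polynomials has coefficients in -1, 0, 1, not all
  zero, with absolute sum at most \<open>m ^ k\<close>. The bound on short arcs applies with this
  sum bound as \<open>H\<close>, and the arc points are pulled back to arguments of the trace
  polynomial.\<close>

lemma separating_statistic:
  fixes p q :: real and m k L :: nat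
  assumes p: "0 \<le> p" "p < 1" and q: "q = 1 - p" and L: "L \<ge> 1"
    and S: "S \<in> cubical_tensors k m" and T: "T \<in> cubical_tensors k m" and "S \<noteq> T"
  shows "\<exists>f :: bool tensor \<Rightarrow> complex.
    (\<forall>X. norm (f X) \<le> real (m ^ k) * exp (k * m * p * pi\<^sup>2 / (2 * q\<^sup>2 * (real L)\<^sup>2))) \<and>
    q ^ k \<le> norm (measure_pmf.expectation (tensor_deletion_channel k m p S) f
      - measure_pmf.expectation (tensor_deletion_channel k m p T) f) * real (m ^ k) ^ (L ^ k - 1)"
proof -
  let ?I = "tensor_indices (replicate k m)"
  have q0: "q > 0" using p q by simp
  define e where "e = (\<lambda>(X :: bool tensor) is. if X is = Some True then 1 else 0 :: complex)"
  define c where "c = (\<lambda>is. e S is - e T is)"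
  obtain is0 where is0: "S is0 \<noteq> T is0" using \<open>S \<noteq> T\<close> by auto
  have dom: "dom S = ?I" "dom T = ?I" using S T by (auto simp: cubical_tensors_def)
  have is0I: "is0 \<in> ?I"
  proof (rule ccontr)
    assume "is0 \<notin> ?I"
    hence "is0 \<notin> dom S" "is0 \<notin> dom T" using dom by auto
    thus False using is0 by (simp add: domIff)
  qed
  then obtain a b where "S is0 = Some a" "T is0 = Some b" using dom by blast
  hence c0: "c is0 \<noteq> 0" using is0 by (cases a; cases b) (auto simp: c_def e_def)
  have norm_c: "norm (c is) \<le> 1" "c is \<noteq> 0 \<Longrightarrow> norm (c is) \<ge> 1" for "is"
    by (auto simp: c_def e_def split: if_splits)
  have "(\<Sum>is\<in>?I. norm (c is)) \<le> real (card ?I) * 1"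
    by (intro sum_bounded_above norm_c)
  hence sum_c: "(\<Sum>is\<in>?I. norm (c is)) \<le> real (m ^ k)" by (simp add: card_tensor_indices)
  obtain \<theta>s where len: "length \<theta>s = k" and \<theta>s: "\<forall>\<theta>\<in>set \<theta>s. \<bar>\<theta>\<bar> \<le> pi / L" and
    big: "1 \<le> norm (\<Sum>is\<in>?I. c is * monomial (map cis \<theta>s) is) * real (m ^ k) ^ (L ^ k - 1)"
    using multivariate_large_on_short_arcs[OF L is0I, of c "real (m ^ k)"] c0 norm_c(2) sum_c by auto
  \<comment> \<open>The solutions \<open>w\<close> of
    \<open>p + q * w = cis \<theta>\<close>.\<close>
  define ws where "ws = map (\<lambda>\<theta>. (cis \<theta> - p) / q) \<theta>s"
  have lenw: "length ws = k" by (simp add: ws_def len)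
  define r where "r = exp (p * (pi / L)\<^sup>2 / (2 * q\<^sup>2))"
  have r1: "r \<ge> 1" using p by (simp add: r_def)
  have wr: "\<forall>w\<in>set ws. norm w \<le> r"
    using norm_affine_cis_le[OF p q] \<theta>s by (auto simp: ws_def r_def)
  have zs: "map (\<lambda>w. p + (1 - p) * w) ws = map cis \<theta>s"
    using q0 unfolding ws_def q[symmetric] by simp
  have rmk: "(r ^ m) ^ k = exp (k * m * p * pi\<^sup>2 / (2 * q\<^sup>2 * (real L)\<^sup>2))"
    unfolding r_def exp_of_nat_mult[symmetric] by (simp add: power_divide mult_ac)
  have E: "measure_pmf.expectation (tensor_deletion_channel k m p X) (trace_statistic k m ws)
      = of_real (q ^ k) * (\<Sum>is\<in>?I. e X is * monomial (map cis \<theta>s) is)" for X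
    using expectation_trace_statistic[of p ws k m X] p lenw unfolding zs q e_def by simp
  have "measure_pmf.expectation (tensor_deletion_channel k m p S) (trace_statistic k m ws)
      - measure_pmf.expectation (tensor_deletion_channel k m p T) (trace_statistic k m ws)
      = of_real (q ^ k) * (\<Sum>is\<in>?I. c is * monomial (map cis \<theta>s) is)"
    unfolding E c_def by (simp add: sum_subtractf algebra_simps)
  hence "norm (measure_pmf.expectation (tensor_deletion_channel k m p S) (trace_statistic k m ws)
      - measure_pmf.expectation (tensor_deletion_channel k m p T) (trace_statistic k m ws))
      = q ^ k * norm (\<Sum>is\<in>?I. c is * monomial (map cis \<theta>s) is)"
    using q0 by (simp add: norm_mult norm_power del: of_real_power)
  moreover have "q ^ k * 1 \<le> q ^ k * (norm (\<Sum>is\<in>?I. c is * monomial (map cis \<theta>s) is) * real (m ^ k) ^ (L ^ k - 1))"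
    using q0 by (intro mult_left_mono big) auto
  ultimately show ?thesis
    using norm_trace_statistic_le[OF wr r1 lenw, of m, unfolded rmk]
    by (intro exI[of _ "trace_statistic k m ws"] conjI allI) (simp_all only: mult_ac mult_1_right)
qed

text \<open>The modulus is at most the sum of the absolute real and imaginary parts, so one of these
  parts keeps half of the gap; hence the factor 2.\<close>

lemma real_separating_statistic:
  fixes p q :: real and m k L :: nat
  assumes p: "0 \<le> p" "p < 1" and q: "q = 1 - p" and L: "L \<ge> 1" and m: "m > 0"
    and S: "S \<in> cubical_tensors k m" and T: "T \<in> cubical_tensors k m" and "S \<noteq> T"
  shows "\<exists>g :: bool tensor \<Rightarrow> real.
    (\<forall>X. \<bar>g X\<bar> \<le> real (m ^ k) * exp (k * m * p * pi\<^sup>2 / (2 * q\<^sup>2 * (real L)\<^sup>2))) \<and>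
    q ^ k / (2 * real (m ^ k) ^ (L ^ k - 1))
      \<le> \<bar>measure_pmf.expectation (tensor_deletion_channel k m p S) g
        - measure_pmf.expectation (tensor_deletion_channel k m p T) g\<bar>"
proof -
  let ?M = "real (m ^ k) * exp (k * m * p * pi\<^sup>2 / (2 * q\<^sup>2 * (real L)\<^sup>2))"
  let ?E = "\<lambda>X. measure_pmf.expectation (tensor_deletion_channel k m p X)"
  obtain f :: "bool tensor \<Rightarrow> complex" where f: "\<And>X. norm (f X) \<le> ?M"
    "q ^ k \<le> norm (?E S f - ?E T f) * real (m ^ k) ^ (L ^ k - 1)"
    using separating_statistic[OF p q L S T \<open>S \<noteq> T\<close>] by blast
  have int: "integrable (measure_pmf (tensor_deletion_channel k m p X)) f" for X
    by (intro integrable_measure_pmf_finite finite_set_channel)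
  have "q ^ k / real (m ^ k) ^ (L ^ k - 1) \<le> norm (?E S f - ?E T f)"
    using f(2) m by (simp add: field_simps)
  also have "\<dots> \<le> \<bar>?E S (\<lambda>X. Re (f X)) - ?E T (\<lambda>X. Re (f X))\<bar> + \<bar>?E S (\<lambda>X. Im (f X)) - ?E T (\<lambda>X. Im (f X))\<bar>"
    using cmod_le[of "?E S f - ?E T f"] by (simp add: integral_Re[OF int] integral_Im[OF int])
  finally have "q ^ k / (2 * real (m ^ k) ^ (L ^ k - 1)) \<le> \<bar>?E S (\<lambda>X. Re (f X)) - ?E T (\<lambda>X. Re (f X))\<bar>
      \<or> q ^ k / (2 * real (m ^ k) ^ (L ^ k - 1)) \<le> \<bar>?E S (\<lambda>X. Im (f X)) - ?E T (\<lambda>X. Im (f X))\<bar>"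
    by (simp add: field_simps) linarith
  moreover have "\<bar>Re (f X)\<bar> \<le> ?M" "\<bar>Im (f X)\<bar> \<le> ?M" for X
    using f(1)[of X] abs_Re_le_cmod[of "f X"] abs_Im_le_cmod[of "f X"] by linarith+
  ultimately show ?thesis
    using exI[of "\<lambda>g. (\<forall>X. \<bar>g X\<bar> \<le> ?M) \<and> q ^ k / (2 * real (m ^ k) ^ (L ^ k - 1)) \<le> \<bar>?E S g - ?E T g\<bar>"
        "\<lambda>X. Re (f X)"]
      exI[of "\<lambda>g. (\<forall>X. \<bar>g X\<bar> \<le> ?M) \<and> q ^ k / (2 * real (m ^ k) ^ (L ^ k - 1)) \<le> \<bar>?E S g - ?E T g\<bar>"
        "\<lambda>X. Im (f X)"]
    by auto
qed

lemma traces_suffice_mono: "traces_suffice k m p N \<delta> \<Longrightarrow> \<delta> \<le> \<delta>' \<Longrightarrow> traces_suffice k m p N \<delta>'"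
  unfolding traces_suffice_def by (meson diff_left_mono order_trans)

lemma traces_suffice_by_statistics:
  fixes p q :: real and m k L N :: nat
  assumes p: "0 \<le> p" "p < 1" and q: "q = 1 - p" and L: "L \<ge> 1" and m: "m > 0" and N: "N > 0"
  defines "M \<equiv> real (m ^ k) * exp (k * m * p * pi\<^sup>2 / (2 * q\<^sup>2 * (real L)\<^sup>2))"
    and "\<Delta> \<equiv> q ^ k / (2 * real (m ^ k) ^ (L ^ k - 1))"
  shows "traces_suffice k m p N (2 * 4 ^ (m ^ k) * exp (- real N * \<Delta>\<^sup>2 / (8 * M\<^sup>2)))"
proof -
  let ?\<Theta> = "cubical_tensors k m :: bool tensor set"
  have pos: "M > 0" "\<Delta> > 0" using m p q by (auto simp: M_def \<Delta>_def)
  have "traces_suffice k m p N (2 * (real (card ?\<Theta>))\<^sup>2 * exp (- real N * \<Delta>\<^sup>2 / (8 * M\<^sup>2)))"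
    unfolding traces_suffice_def
    by (rule pairwise_tests_suffice[OF cubical_tensors_finite_card(1) N pos])
       (use real_separating_statistic[OF p q L m] in \<open>auto simp: M_def \<Delta>_def\<close>)
  moreover have "(real (card ?\<Theta>))\<^sup>2 \<le> (2 ^ (m ^ k))\<^sup>2"
    using cubical_tensors_finite_card(2)[of k m] by (intro power_mono) (simp_all flip: of_nat_le_iff)
  moreover have "(2 ^ (m ^ k))\<^sup>2 = (4 :: real) ^ (m ^ k)" by (simp add: power_mult[symmetric] mult.commute power_mult)
  ultimately show ?thesis
    by (elim traces_suffice_mono) (intro mult_right_mono mult_left_mono, auto)
qed

section \<open>Sample sizes\<close>

text \<open>With \<open>b = m * p / q\<^sup>2\<close> and \<open>l = ln m\<close>, the base equals
  \<open>real k ^ (k + 2) * b ^ k * l\<^sup>2\<close>: the factor \<open>k\<close> from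
  \<open>ln (m ^ k)\<close> completes the power whose root is exactly \<open>k\<close>. This keeps
  the final constant independent of \<open>k\<close>.\<close>

lemma rate_eq:
  fixes k m :: nat and p q :: real
  assumes k: "k \<ge> 1" and m: "m \<ge> 2" and p: "p > 0" and q: "q > 0"
  shows "(real (m ^ k) * (real k * p / q\<^sup>2) ^ k * (ln (real (m ^ k)))\<^sup>2) powr (1 / (real k + 2))
    = k * exp ((k * ln (m * p / q\<^sup>2) + 2 * ln (ln m)) / (real k + 2))"
proof -
  define b where "b = m * p / q\<^sup>2"
  define l where "l = ln (real m)"
  have pos: "b > 0" "l > 0" "real k > 0" using k m p q by (auto simp: b_def l_def)
  have "real (m ^ k) * (real k * p / q\<^sup>2) ^ k * (ln (real (m ^ k)))\<^sup>2 = real k ^ (k + 2) * b ^ k * l\<^sup>2"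
    using m by (simp add: b_def l_def ln_realpow power_divide power_mult_distrib power_add power2_eq_square)
  moreover have "ln (real k ^ (k + 2) * b ^ k * l\<^sup>2) = (real k + 2) * ln k + (k * ln b + 2 * ln l)"
    using pos by (simp add: ln_mult_pos ln_realpow algebra_simps)
  ultimately have "(real (m ^ k) * (real k * p / q\<^sup>2) ^ k * (ln (real (m ^ k)))\<^sup>2) powr (1 / (real k + 2))
      = exp (((real k + 2) * ln k + (k * ln b + 2 * ln l)) / (real k + 2))"
    using pos by (simp add: powr_def)
  also have "((real k + 2) * ln k + (k * ln b + 2 * ln l)) / (real k + 2)
      = ln k + (k * ln b + 2 * ln l) / (real k + 2)"
    by (simp add: add_divide_distrib)
  finally show ?thesis using pos by (simp add: exp_add b_def l_def)
qed

text \<open>From \<open>1 / q = 1 + p / q\<close>, which is at most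
  \<open>1 + p / q\<^sup>2\<close>. It expresses survival through the quantity that occurs in the
  rate.\<close>

lemma exp_minus_deletion_odds_le:
  fixes p q :: real
  assumes "0 \<le> p" "p < 1" "q = 1 - p"
  shows "exp (- (p / q\<^sup>2)) \<le> q"
proof -
  have q: "0 < q" "q \<le> 1" using assms by auto
  have "1 / q = 1 + p / q" using q assms(3) by (simp add: field_simps)
  also have "p / q \<le> p / q\<^sup>2"
    using q assms(1) by (intro divide_left_mono) (auto simp: power2_eq_square mult_le_one)
  also have "1 + p / q\<^sup>2 \<le> exp (p / q\<^sup>2)" by (rule exp_ge_add_one_self)
  finally have "inverse (exp (p / q\<^sup>2)) \<le> inverse (1 / q)" using q by (intro le_imp_inverse_le) auto
  thus ?thesis by (simp add: exp_minus)
qed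

lemma one_minus_power_le_exp:
  fixes x :: real
  assumes "x \<le> 1"
  shows "(1 - x) ^ N \<le> exp (- (N * x))"
proof -
  have "(1 - x) ^ N \<le> exp (- x) ^ N"
    using assms exp_ge_add_one_self[of "- x"] by (intro power_mono) auto
  thus ?thesis by (simp add: exp_of_nat_mult[symmetric])
qed

lemma nat_floor_exp_ge:
  fixes x :: real
  assumes "x \<ge> 0"
  shows "real (nat \<lfloor>exp x\<rfloor>) \<le> exp x" "real (nat \<lfloor>exp x\<rfloor>) \<ge> exp x / 2" "nat \<lfloor>exp x\<rfloor> > 0"
proof -
  have "exp x \<ge> 1" using assms by simp
  hence "\<lfloor>exp x\<rfloor> \<ge> 1" by linarith
  thus "real (nat \<lfloor>exp x\<rfloor>) \<le> exp x" "real (nat \<lfloor>exp x\<rfloor>) \<ge> exp x / 2" "nat \<lfloor>exp x\<rfloor> > 0"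
    by linarith+
qed

text \<open>A trace is complete with probability \<open>q ^ (k * m)\<close>, which is at least
  \<open>exp (- E)\<close>, so about \<open>exp (100 * E)\<close> traces contain at least
  \<open>exp (99 * E) / 2\<close> complete ones on average. The hypothesis \<open>low\<close> forces
  \<open>E\<close> to grow with \<open>l\<close>.\<close>

lemma waiting_time_bound:
  fixes k m :: nat and p q l :: real
  assumes k: "k \<ge> 1" and m: "m \<ge> 1" and p: "0 < p" "p < 1" and q: "q = 1 - p" and l: "l \<ge> 1"
    and low: "l powr (- (1 / k)) < k * m * p" and up: "m * p / q\<^sup>2 \<le> l"
  defines "E \<equiv> k * exp ((k * ln (m * p / q\<^sup>2) + 2 * ln l) / (real k + 2))"
  shows "(1 - q ^ (k * m)) ^ nat \<lfloor>exp (100 * E)\<rfloor> \<le> exp (- (exp (l powr (1 / (real k + 2))) / 2))"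
proof -
  define b where "b = m * p / q\<^sup>2"
  let ?N = "nat \<lfloor>exp (100 * E)\<rfloor>"
  have q0: "0 < q" "q \<le> 1" using p q by auto
  have b0: "b > 0" using m p q0 by (simp add: b_def)
  have E0: "E \<ge> 0" by (simp add: E_def)
  have E_b: "E = k * exp ((k * ln b + 2 * ln l) / (real k + 2))" by (simp add: E_def b_def)
  \<comment> \<open>As \<open>b \<le> l\<close>, replacing two of the \<open>k + 2\<close> factors
    \<open>b\<close> by \<open>l\<close> can only increase the geometric mean.\<close>
  have kb: "k * b \<le> E"
  proof -
    have "(real k + 2) * ln b \<le> k * ln b + 2 * ln l"
      using up[folded b_def] b0 l by (simp add: algebra_simps)
    hence "ln b \<le> (k * ln b + 2 * ln l) / (real k + 2)"
      by (simp add: pos_le_divide_eq mult.commute)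
    hence "exp (ln b) \<le> exp ((k * ln b + 2 * ln l) / (real k + 2))" by simp
    thus ?thesis using b0 unfolding E_b by (intro mult_left_mono) auto
  qed
  \<comment> \<open>The threshold \<open>l powr (- (1 / k))\<close> is such that
    \<open>(k * b) ^ k\<close> is at least \<open>1 / l\<close>; against \<open>l\<^sup>2\<close> in
    the rate this leaves one factor \<open>l\<close>.\<close>
  have E_low: "l powr (1 / (real k + 2)) \<le> E"
  proof -
    have "m * p * 1 \<le> m * p * (1 / q\<^sup>2)"
      using p q0 by (intro mult_left_mono) (auto simp: power_le_one)
    hence "m * p \<le> b" by (simp add: b_def)
    hence "k * (m * p) \<le> k * b" by (rule mult_left_mono) simp
    hence "l powr (- (1 / k)) \<le> k * b" using low by (simp add: mult_ac)
    hence "ln (l powr (- (1 / k))) \<le> ln (k * b)" using l by (intro ln_mono) auto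
    hence "- (ln l / k) \<le> ln k + ln b" using k b0 l by (simp add: ln_powr ln_mult_pos)
    hence "- ln l \<le> k * (ln k + ln b)" using k by (simp add: field_simps)
    hence "ln l \<le> (k * ln b + 2 * ln l) + k * ln k" by (simp add: algebra_simps)
    also have "\<dots> \<le> (k * ln b + 2 * ln l) + (real k + 2) * ln k"
      using k by (intro add_left_mono mult_right_mono) auto
    finally have "ln l / (real k + 2) \<le> ((k * ln b + 2 * ln l) + (real k + 2) * ln k) / (real k + 2)"
      by (intro divide_right_mono) auto
    also have "\<dots> = (k * ln b + 2 * ln l) / (real k + 2) + ln k"
      by (simp add: add_divide_distrib)
    finally have "exp (ln l / (real k + 2)) \<le> exp ((k * ln b + 2 * ln l) / (real k + 2) + ln k)" by simp
    thus ?thesis using k l unfolding E_b by (simp add: exp_add powr_def mult.commute)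
  qed
  have "exp (- (k * b)) = exp (- (p / q\<^sup>2)) ^ (k * m)"
    by (simp add: b_def exp_of_nat_mult[symmetric] mult_ac)
  also have "\<dots> \<le> q ^ (k * m)"
    using exp_minus_deletion_odds_le[of p q] p q by (intro power_mono) auto
  finally have "exp (- E) \<le> q ^ (k * m)" using kb by (meson exp_le_cancel_iff neg_le_iff_le order_trans)
  hence "exp (100 * E) / 2 * exp (- E) \<le> ?N * q ^ (k * m)"
    using nat_floor_exp_ge[of "100 * E"] E0 by (intro mult_mono) auto
  moreover have "exp (100 * E) / 2 * exp (- E) = exp (99 * E) / 2" by (simp add: exp_add[symmetric])
  moreover have "exp (l powr (1 / (real k + 2))) \<le> exp (99 * E)" using E_low E0 by simp
  ultimately have "exp (l powr (1 / (real k + 2))) / 2 \<le> ?N * q ^ (k * m)" by linarith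
  thus ?thesis
    using one_minus_power_le_exp[of "q ^ (k * m)" ?N] q0
    by (intro order_trans[OF one_minus_power_le_exp]) (auto simp: power_le_one)
qed

text \<open>For a suitable \<open>L\<close>, both the smallness of the gap and the size of the
  statistic cost a factor exponential in a constant multiple of \<open>E\<close>, and
  \<open>exp (100 * E)\<close> samples outweigh the squared ratio.\<close>

lemma statistic_sample_bound:
  fixes k m :: nat and p q l :: real
  assumes k: "k \<ge> 1" and m: "m \<ge> 3" and p: "0 < p" "p < 1" and q: "q = 1 - p"
    and l: "l = ln m" and b: "l < m * p / q\<^sup>2"
  defines "E \<equiv> k * exp ((k * ln (m * p / q\<^sup>2) + 2 * ln l) / (real k + 2))"
  shows "\<exists>L\<ge>1. 3 * real (m ^ k) \<le> real (nat \<lfloor>exp (100 * E)\<rfloor>) *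
      (q ^ k / (2 * real (m ^ k) ^ (L ^ k - 1)))\<^sup>2 /
      (8 * (real (m ^ k) * exp (k * m * p * pi\<^sup>2 / (2 * q\<^sup>2 * (real L)\<^sup>2)))\<^sup>2)"
proof -
  define b where "b = m * p / q\<^sup>2"
  define n where "n = real (m ^ k)"
  let ?N = "nat \<lfloor>exp (100 * E)\<rfloor>"
  have q0: "0 < q" "q \<le> 1" using p q by auto
  have l1: "l \<ge> 1"
    unfolding l using m exp_le by (subst ln_ge_iff) auto
  have lb: "l < b" using assms(7) by (simp add: b_def)
  have b1: "b > 1" using l1 lb by simp
  have n1: "n \<ge> 1" using m by (simp add: n_def)
  have lnn: "ln n = k * l" using m by (simp add: n_def l ln_realpow)
  \<comment> \<open>\<open>exp s\<close> is the ideal real value of \<open>L\<close>: it equates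
    \<open>k * l * exp s ^ k\<close> and \<open>k * b / (exp s)\<^sup>2\<close>, and by
    \<open>E1\<close> and \<open>E2\<close> both are then \<open>E\<close>.\<close>
  define s where "s = (ln b - ln l) / (real k + 2)"
  have s0: "s \<ge> 0" using lb l1 by (simp add: s_def)
  have E1: "E = k * (exp s ^ k * l)"
  proof -
    have "(k * ln b + 2 * ln l) / (real k + 2) = k * s + ln l"
      by (simp add: s_def field_simps)
    thus ?thesis using l1 by (simp add: E_def b_def[symmetric] exp_add exp_of_nat_mult)
  qed
  have E2: "k * b = E * (exp s)\<^sup>2"
  proof -
    have "(k * ln b + 2 * ln l) / (real k + 2) + 2 * s = (k * ln b + 2 * ln l + 2 * (ln b - ln l)) / (real k + 2)"
      by (simp only: s_def add_divide_distrib times_divide_eq_right)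
    also have "k * ln b + 2 * ln l + 2 * (ln b - ln l) = (real k + 2) * ln b" by (simp add: algebra_simps)
    finally have "(k * ln b + 2 * ln l) / (real k + 2) + 2 * s = ln b" by simp
    hence "exp ((k * ln b + 2 * ln l) / (real k + 2)) * exp (2 * s) = b"
      using b1 by (simp add: exp_add[symmetric])
    thus ?thesis by (simp add: E_def b_def[symmetric] exp_double mult.assoc)
  qed
  have kl: "k * l \<le> E"
    unfolding E1 using s0 l1 by (intro mult_left_mono) (auto simp: mult_ge1_I)
  have k_E: "k \<le> E" using mult_left_mono[OF l1, of k] kl by simp
  have E_ge1: "E \<ge> 1" using k_E k by simp
  have n_le: "n \<le> exp E" using kl n1 lnn by (metis exp_le_cancel_iff exp_ln less_le_trans zero_less_one)
  \<comment> \<open>Since \<open>s \<ge> 0\<close>, rounding down loses at most a factor 2 and keeps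
    \<open>L \<ge> 1\<close>.\<close>
  define L where "L = nat \<lfloor>exp s\<rfloor>"
  have L: "real L \<le> exp s" "exp s / 2 \<le> real L" "L \<ge> 1"
    using nat_floor_exp_ge[OF s0] unfolding L_def by linarith+
  have term1: "n ^ (L ^ k) \<le> exp E"
  proof -
    have "real (L ^ k) * (k * l) \<le> exp s ^ k * (k * l)"
      using L(1) l1 by (intro mult_right_mono) (auto intro!: power_mono)
    hence "real (L ^ k) * ln n \<le> E" by (simp add: lnn E1 mult_ac)
    hence "exp (real (L ^ k) * ln n) \<le> exp E" by simp
    thus ?thesis using n1 by (simp only: exp_of_nat_mult) simp
  qed
  \<comment> \<open>The constant 32 comes from \<open>exp s \<le> 2 * L\<close> and
    \<open>pi < 4\<close>.\<close>
  have term2: "k * m * p * pi\<^sup>2 / (2 * q\<^sup>2 * (real L)\<^sup>2) \<le> 32 * E"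
  proof -
    have "k * m * p * pi\<^sup>2 / (2 * q\<^sup>2 * (real L)\<^sup>2) = k * b * (pi\<^sup>2 / (2 * (real L)\<^sup>2))"
      by (simp add: b_def)
    also have "\<dots> = E * ((exp s)\<^sup>2 * (pi\<^sup>2 / (2 * (real L)\<^sup>2)))" by (simp only: E2 mult.assoc)
    also have "(exp s)\<^sup>2 * (pi\<^sup>2 / (2 * (real L)\<^sup>2)) \<le> (2 * real L)\<^sup>2 * (4\<^sup>2 / (2 * (real L)\<^sup>2))"
      using L pi_less_4 by (intro mult_mono divide_right_mono power_mono) auto
    hence "E * ((exp s)\<^sup>2 * (pi\<^sup>2 / (2 * (real L)\<^sup>2))) \<le> E * ((2 * real L)\<^sup>2 * (4\<^sup>2 / (2 * (real L)\<^sup>2)))"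
      by (rule mult_left_mono) (use E_ge1 in simp)
    also have "(2 * real L)\<^sup>2 * (4\<^sup>2 / (2 * (real L)\<^sup>2)) = 32"
      using L(3) by (simp add: field_simps)
    finally show ?thesis by simp
  qed
  \<comment> \<open>The factor \<open>q ^ k\<close> has to be absorbed uniformly in
    \<open>q\<close>. For \<open>q \<ge> 1 / 2\<close>, \<open>- ln q\<close> is at most 1. For
    smaller \<open>q\<close>, \<open>p * m \<ge> 1\<close> gives
    \<open>1 / q\<^sup>2 \<le> b\<close>, and \<open>E\<close> is at least
    \<open>k * ln b / 3\<close>.\<close>
  have term3: "exp (- (2 * E)) \<le> q ^ k"
  proof -
    have "- ln q * k \<le> 2 * E"
    proof (cases "q \<ge> 1 / 2")
      case True
      have "- ln q = ln (1 / q)" using q0 by (simp add: ln_div)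
      also have "\<dots> \<le> 1 / q - 1" using q0 by (intro ln_le_minus_one) auto
      also have "\<dots> \<le> 1" using True q0 by (simp add: field_simps)
      finally have "- ln q * k \<le> 1 * real k" by (rule mult_right_mono) simp
      thus ?thesis using k_E E_ge1 by simp
    next
      case False
      hence "1 / 2 * 2 \<le> p * m" using q m by (intro mult_mono) auto
      hence "1 / q\<^sup>2 \<le> b" using q0 by (simp add: b_def field_simps)
      hence "ln (1 / q\<^sup>2) \<le> ln b" using q0 by (intro ln_mono) auto
      hence q_b: "- ln q \<le> ln b / 2" using q0 by (simp add: ln_div ln_realpow)
      have "ln b / 3 \<le> (k * ln b + 2 * ln l) / (real k + 2)"
      proof -
        have "(real k + 2) * ln b \<le> 3 * (k * ln b)"
          using mult_right_mono[of 1 "real k" "2 * ln b"] k b1 by (simp add: algebra_simps)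
        also have "\<dots> \<le> 3 * (k * ln b + 2 * ln l)" using l1 by simp
        finally show ?thesis by (simp add: field_simps)
      qed
      also have "\<dots> \<le> exp ((k * ln b + 2 * ln l) / (real k + 2))"
        using exp_ge_add_one_self[of "(k * ln b + 2 * ln l) / (real k + 2)"] by linarith
      finally have "k * (ln b / 3) \<le> E"
        unfolding E_def b_def[symmetric] by (rule mult_left_mono) simp
      moreover have "- ln q * k \<le> ln b / 2 * k" using q_b by (intro mult_right_mono) auto
      ultimately show ?thesis using E_ge1 by (simp add: field_simps)
    qed
    hence "exp (- (2 * E)) \<le> exp (k * ln q)" by (simp add: mult.commute)
    thus ?thesis using q0 by (simp add: exp_of_nat_mult)
  qed
  define M where "M = n * exp (k * m * p * pi\<^sup>2 / (2 * q\<^sup>2 * (real L)\<^sup>2))"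
  define \<Delta> where "\<Delta> = q ^ k / (2 * n ^ (L ^ k - 1))"
  have pos: "M > 0" "\<Delta> > 0" using n1 q0 by (auto simp: M_def \<Delta>_def)
  \<comment> \<open>Here \<open>35 = 1 + 32 + 2\<close>, from \<open>term1\<close>,
    \<open>term2\<close> and \<open>term3\<close>; the factor \<open>n\<close> in \<open>M\<close>
    restores the full power \<open>n ^ (L ^ k)\<close>.\<close>
  have "M \<le> \<Delta> * (2 * exp (35 * E))"
  proof -
    have "M * (2 * n ^ (L ^ k - 1)) = 2 * n ^ (L ^ k) * exp (k * m * p * pi\<^sup>2 / (2 * q\<^sup>2 * (real L)\<^sup>2))"
      using L(3) power_Suc[of n "L ^ k - 1"] by (simp add: M_def)
    also have "\<dots> \<le> 2 * exp E * exp (32 * E)"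
      using term1 term2 n1 by (intro mult_mono) auto
    also have "\<dots> = exp (- (2 * E)) * (2 * exp (35 * E))" by (simp add: exp_add[symmetric])
    also have "\<dots> \<le> q ^ k * (2 * exp (35 * E))" using term3 by (intro mult_right_mono) auto
    finally show ?thesis using n1 by (simp add: \<Delta>_def field_simps)
  qed
  hence "M\<^sup>2 \<le> (\<Delta> * (2 * exp (35 * E)))\<^sup>2" using pos by (intro power_mono) auto
  also have "\<dots> = 4 * \<Delta>\<^sup>2 * exp (70 * E)"
    by (simp add: power_mult_distrib exp_double[symmetric])
  finally have M2: "M\<^sup>2 \<le> 4 * \<Delta>\<^sup>2 * exp (70 * E)" .
  \<comment> \<open>\<open>100 = 1 + 70 + 29\<close>: the exponents of \<open>n\<close> and of
    \<open>M\<^sup>2\<close>, and a reserve for the constant \<open>192 = 2 * 3 * 8 * 4\<close>,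
    whose factor 2 pays for the floor in the sample size.\<close>
  have "192 \<le> exp (29 * E)"
  proof -
    have "(192 :: real) \<le> 2 ^ 29" by simp
    also have "\<dots> \<le> exp 1 ^ 29" using exp_ge_add_one_self[of 1] by (intro power_mono) auto
    also have "\<dots> = exp 29" by (simp add: exp_of_nat_mult[symmetric])
    also have "\<dots> \<le> exp (29 * E)" using E_ge1 by simp
    finally show ?thesis .
  qed
  hence "192 * (exp E * exp (70 * E)) \<le> exp (29 * E) * (exp E * exp (70 * E))"
    by (intro mult_right_mono) auto
  also have "\<dots> = exp (100 * E)" by (simp add: exp_add[symmetric])
  finally have N: "96 * (exp E * exp (70 * E)) \<le> ?N"
    using nat_floor_exp_ge(2)[of "100 * E"] E_ge1 by simp
  have "3 * n * (8 * M\<^sup>2) \<le> 3 * exp E * (8 * (4 * \<Delta>\<^sup>2 * exp (70 * E)))"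
    using n_le M2 n1 by (intro mult_mono) auto
  also have "\<dots> = 96 * (exp E * exp (70 * E)) * \<Delta>\<^sup>2" by simp
  also have "\<dots> \<le> ?N * \<Delta>\<^sup>2" by (intro mult_right_mono N) auto
  finally have "3 * n \<le> ?N * \<Delta>\<^sup>2 / (8 * M\<^sup>2)" using pos by (simp add: pos_le_divide_eq)
  thus ?thesis using L(3) unfolding M_def \<Delta>_def n_def by blast
qed

text \<open>The summands cover, in order: the finitely many \<open>n\<close> with \<open>m < 3\<close>; a single trace when deletions are
  unlikely; waiting for a trace without deletions; the polynomial statistics.\<close>

definition failure_bound :: "nat \<Rightarrow> nat \<Rightarrow> real" where
  "failure_bound k n = (if n < 3 ^ k then 1 else 0) + (ln n / k) powr (- (1 / k))
     + exp (- (exp ((ln n / k) powr (1 / (real k + 2))) / 2)) + 2 * exp (- real n)"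

lemma failure_bound_tendsto_0:
  assumes "k \<ge> 1"
  shows "failure_bound k \<longlonglongrightarrow> 0"
proof -
  have lim: "filterlim (\<lambda>n. ln (real n) / k) at_top sequentially"
    using assms by real_asymp
  have "(\<lambda>n. if n < 3 ^ k then 1 else 0 :: real) \<longlonglongrightarrow> 0"
    by (rule tendsto_eventually) (auto intro!: eventually_sequentiallyI[of "3 ^ k"])
  moreover have "((\<lambda>x::real. x powr (- (1 / k))) \<longlongrightarrow> 0) at_top"
    using assms by (intro tendsto_neg_powr filterlim_ident) auto
  hence "(\<lambda>n. (ln (real n) / k) powr (- (1 / k))) \<longlonglongrightarrow> 0"
    by (rule filterlim_compose[OF _ lim])
  moreover have "filterlim (\<lambda>x::real. x powr (1 / (real k + 2))) at_top at_top"
    by (rule real_powr_at_top) auto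
  hence "filterlim (\<lambda>n. (ln (real n) / k) powr (1 / (real k + 2))) at_top sequentially"
    by (rule filterlim_compose[OF _ lim])
  moreover have "((\<lambda>x::real. exp (- (exp x / 2))) \<longlongrightarrow> 0) at_top" by real_asymp
  ultimately have "(\<lambda>n. if n < 3 ^ k then 1 else 0 :: real) \<longlonglongrightarrow> 0"
    "(\<lambda>n. (ln (real n) / k) powr (- (1 / k))) \<longlonglongrightarrow> 0"
    "(\<lambda>n. exp (- (exp ((ln (real n) / k) powr (1 / (real k + 2))) / 2))) \<longlonglongrightarrow> 0"
    by (auto elim: filterlim_compose)
  moreover have "(\<lambda>n. 2 * exp (- real n)) \<longlonglongrightarrow> 0" by real_asymp
  ultimately have "(\<lambda>n. failure_bound k n) \<longlonglongrightarrow> 0 + 0 + 0 + 0"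
    unfolding failure_bound_def by (intro tendsto_add)
  thus ?thesis by simp
qed

text \<open>The constant is absolute. The vanishing failure probability depends on \<open>k\<close>
  and \<open>n\<close> but is uniform in \<open>p\<close>, which may therefore vary with
  \<open>n\<close>.\<close>

theorem theorem14:
  shows "\<exists>C::real. C > 0 \<and> (\<forall>k::nat. k \<ge> 1 \<longrightarrow>
    (\<exists>\<epsilon> :: nat \<Rightarrow> real. \<epsilon> \<longlonglongrightarrow> 0 \<and>
      (\<forall>(p::real) (q::real) (n::nat) (m::nat).
        0 \<le> p \<and> p < 1 \<and> q = 1 - p \<and> n \<ge> 1 \<and> n = m ^ k \<longrightarrow>
        (\<exists>N::nat.
          real N \<le> exp (C * (real n * (real k * p / q\<^sup>2) ^ k * (ln (real n))\<^sup>2) powr (1 / (real k + 2))) \<and>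
          traces_suffice k m p N (\<epsilon> n)))))"
proof (intro exI[of _ "100 :: real"] conjI allI impI)
  fix k :: nat
  assume k: "k \<ge> 1"
  show "\<exists>\<epsilon> :: nat \<Rightarrow> real. \<epsilon> \<longlonglongrightarrow> 0 \<and>
      (\<forall>(p::real) (q::real) (n::nat) (m::nat).
        0 \<le> p \<and> p < 1 \<and> q = 1 - p \<and> n \<ge> 1 \<and> n = m ^ k \<longrightarrow>
        (\<exists>N::nat.
          real N \<le> exp (100 * (real n * (real k * p / q\<^sup>2) ^ k * (ln (real n))\<^sup>2) powr (1 / (real k + 2))) \<and>
          traces_suffice k m p N (\<epsilon> n)))"
  proof (intro exI[of _ "failure_bound k"] conjI allI impI failure_bound_tendsto_0 k)
    fix p q :: real and n m :: nat
    assume "0 \<le> p \<and> p < 1 \<and> q = 1 - p \<and> n \<ge> 1 \<and> n = m ^ k"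
    hence p: "0 \<le> p" "p < 1" and q: "q = 1 - p" and n: "n = m ^ k" and "n \<ge> 1"
      by auto
    have m: "m > 0" using n \<open>n \<ge> 1\<close> k by (cases "m = 0") (auto simp: power_0_left)
    have q0: "q > 0" using p q by simp
    define E where "E = (real n * (real k * p / q\<^sup>2) ^ k * (ln (real n))\<^sup>2) powr (1 / (real k + 2))"
    have E0: "E \<ge> 0" by (simp add: E_def)
    define l where "l = ln (real m)"
    have lnk: "ln (real n) / k = l" using m k by (simp add: n l_def ln_realpow)
    have bound_ge:
      "(if n < 3 ^ k then 1 else 0) \<le> failure_bound k n"
      "l powr (- (1 / k)) \<le> failure_bound k n"
      "exp (- (exp (l powr (1 / (real k + 2))) / 2)) \<le> failure_bound k n"
      "2 * exp (- real n) \<le> failure_bound k n"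
      by (auto simp: failure_bound_def lnk)
    have "\<exists>N::nat. real N \<le> exp (100 * E) \<and> traces_suffice k m p N (failure_bound k n)"
    \<comment> \<open>For \<open>m < 3\<close> the failure bound is at least 1, so zero traces
      suffice; for larger \<open>m\<close>, \<open>ln m \<ge> 1\<close>.\<close>
    proof (cases "m < 3")
      case True
      hence "n < 3 ^ k" using k unfolding n by (intro power_strict_mono) auto
      hence "traces_suffice k m p 0 (failure_bound k n)"
        using bound_ge(1) p m by (intro traces_suffice_if_full_trace) auto
      thus ?thesis by (intro exI[of _ 0]) simp
    next
      case False
      hence m3: "m \<ge> 3" by simp
      have l1: "l \<ge> 1" unfolding l_def using m3 exp_le by (subst ln_ge_iff) auto
      show ?thesis
      \<comment> \<open>Here one trace is complete except with probability \<open>k * m * p\<close>,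
        by Bernoulli's inequality. This case contains \<open>p = 0\<close>, where the rate vanishes
        and only one trace is allowed.\<close>
      proof (cases "k * m * p \<le> l powr (- (1 / k))")
        case True
        have "1 - real (k * m) * p \<le> (1 - p) ^ (k * m)"
          using Bernoulli_inequality[of "- p" "k * m"] p by simp
        hence "traces_suffice k m p 1 (failure_bound k n)"
          using True bound_ge(2) p m by (intro traces_suffice_if_full_trace) auto
        thus ?thesis using E0 by (intro exI[of _ 1]) simp
      next
        case large: False
        have p0: "p > 0" using large p(1) l1 by (cases "p = 0") auto
        have E: "E = k * exp ((k * ln (m * p / q\<^sup>2) + 2 * ln l) / (real k + 2))"
          unfolding E_def n l_def using k m3 p0 q0 by (intro rate_eq) auto
        let ?N = "nat \<lfloor>exp (100 * E)\<rfloor>"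
        have N: "real ?N \<le> exp (100 * E)" "?N > 0"
          using nat_floor_exp_ge[of "100 * E"] E0 by auto
        have "traces_suffice k m p ?N (failure_bound k n)"
        \<comment> \<open>Below this threshold the balancing value of \<open>L\<close> would drop
          under 1 and complete traces are awaited instead.\<close>
        proof (cases "m * p / q\<^sup>2 \<le> l")
          case True
          have "(1 - q ^ (k * m)) ^ ?N \<le> exp (- (exp (l powr (1 / (real k + 2))) / 2))"
            unfolding E using large True k m p0 p(2) q l1 by (intro waiting_time_bound) auto
          thus ?thesis
            using bound_ge(3) p m unfolding q by (intro traces_suffice_if_full_trace) auto
        next
          case False
          then obtain L where L: "L \<ge> 1" and
            big: "3 * real (m ^ k) \<le> real ?N * (q ^ k / (2 * real (m ^ k) ^ (L ^ k - 1)))\<^sup>2 /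
              (8 * (real (m ^ k) * exp (k * m * p * pi\<^sup>2 / (2 * q\<^sup>2 * (real L)\<^sup>2)))\<^sup>2)"
            using statistic_sample_bound[OF k m3 p0 p(2) q l_def] unfolding E by auto
          define x where "x = real ?N * (q ^ k / (2 * real (m ^ k) ^ (L ^ k - 1)))\<^sup>2 /
              (8 * (real (m ^ k) * exp (k * m * p * pi\<^sup>2 / (2 * q\<^sup>2 * (real L)\<^sup>2)))\<^sup>2)"
          have "traces_suffice k m p ?N (2 * 4 ^ n * exp (- x))"
            using traces_suffice_by_statistics[OF p q L m N(2), of k] unfolding x_def n by simp
          \<comment> \<open>The union bound costs \<open>exp (2 * n)\<close> and each test fails
            with a factor \<open>exp (- 3 * n)\<close>, so \<open>exp (- n)\<close> remains.\<close>
          moreover have "(4 :: real) ^ n \<le> exp (2 * n)"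
          proof -
            have "(2 :: real) \<le> exp 1" using exp_ge_add_one_self[of 1] by simp
            hence "(2 :: real)\<^sup>2 \<le> exp 1 ^ 2" by (intro power_mono) auto
            hence "(4 :: real) ^ n \<le> exp 2 ^ n" by (intro power_mono) (auto simp: exp_of_nat_mult[symmetric])
            thus ?thesis by (simp add: exp_of_nat_mult[symmetric] mult.commute)
          qed
          hence "2 * 4 ^ n * exp (- x) \<le> 2 * exp (2 * n) * exp (- (3 * real n))"
            using big unfolding x_def n by (intro mult_mono) auto
          hence "2 * 4 ^ n * exp (- x) \<le> 2 * exp (- real n)" by (simp add: exp_add[symmetric])
          ultimately show ?thesis using bound_ge(4) by (blast intro: traces_suffice_mono order_trans)
        qed
        thus ?thesis using N(1) by blast
      qed
    qed
    thus "\<exists>N::nat. real N \<le> exp (100 * (real n * (real k * p / q\<^sup>2) ^ k * (ln (real n))\<^sup>2) powr (1 / (real k + 2))) \<and>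
          traces_suffice k m p N (failure_bound k n)"
      unfolding E_def .
  qed
qed simp

end
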